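(* Let $n\ge 3$. If $t \in \Xi_n$ is a vertex, then the number $\omega_n$ of vertices in $\Xi_n$ close to $t$ is $$\frac{q^n - 1}{q - 1} \cdot \frac{q^{n-1} - 1}{q - 1} \cdot q$$ (independent of $t$).
   Context: $K$ is a (nonarchimedean) local field with discrete valuation $\mathrm{ord}$, valuation ring $\mathcal{O}$, uniformizer $\pi$ and residue field $k \cong \mathbb{F}_q$. A lattice in a finite-dimensional $K$-vector space $V$ is a free $\mathcal{O}$-submodule of $V$ of rank $\dim_K V$; lattices $L, L'$ in $V$ are homothetic if $L' = \alpha L$ for some $\alpha \in K^\times$, and $[L]$ denotes the homothety class of $L$. The affine building $\Xi_n$ of $\mathrm{SL}_n(K)$ is the following simplicial complex of dimension $n-1$. Fix an $n$-dimensional $K$-vector space $V$. Vertices are homothety classes of lattices in $V$. Vertices $t,t'$ are incident if there are $L \in t$, $L' \in t'$ with $\pi L \subseteq L' \subseteq L$. Simplices are the finite sets of pairwise incident vertices. A chamber is a maximal simplex; it has $n$ vertices $t_0,\dots,t_{n-1}$ with representatives $L_i \in t_i$ such that $\pi L_0 \subsetneq L_1 \subsetneq \cdots \subsetneq L_{n-1} \subsetneq L_0$ and $[L_1:\pi L_0] = q = [L_i : L_{i-1}]$ for $2 \le i \le n-1$. Two chambers are adjacent if they share a codimension-one face. Two vertices $t,t'$ are close if there are adjacent chambers $C, C'$ with $t \in C$, $t' \in C'$, but $t,t' \notin C \cap C'$. *)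

theory Defs
  imports Complex_Main
begin

(* A discrete valuation is given by ord :: 'a => int.  Mathematically ord 0 = infinity, so the
   value of the HOL function at 0 carries no information: the axioms below never mention it, and
   all other uses of ord go through ord_ge, which treats 0 as having infinite valuation. *)

definition ord_ge :: "('a::field \<Rightarrow> int) \<Rightarrow> int \<Rightarrow> 'a \<Rightarrow> bool" where
  "ord_ge ord N x \<longleftrightarrow> x = 0 \<or> N \<le> ord x"

definition valuation_ring :: "('a::field \<Rightarrow> int) \<Rightarrow> 'a set" where
  "valuation_ring ord = {x. ord_ge ord 0 x}"

definition maximal_ideal :: "('a::field \<Rightarrow> int) \<Rightarrow> 'a set" where
  "maximal_ideal ord = {x. ord_ge ord 1 x}"

definition residue_field :: "('a::field \<Rightarrow> int) \<Rightarrow> 'a set set" where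
  "residue_field ord = valuation_ring ord //
     {(x, y). x \<in> valuation_ring ord \<and> y \<in> valuation_ring ord \<and> x - y \<in> maximal_ideal ord}"

definition val_Cauchy :: "('a::field \<Rightarrow> int) \<Rightarrow> (nat \<Rightarrow> 'a) \<Rightarrow> bool" where
  "val_Cauchy ord X \<longleftrightarrow> (\<forall>N. \<exists>M. \<forall>i\<ge>M. \<forall>j\<ge>M. ord_ge ord N (X i - X j))"

definition val_tendsto :: "('a::field \<Rightarrow> int) \<Rightarrow> (nat \<Rightarrow> 'a) \<Rightarrow> 'a \<Rightarrow> bool" where
  "val_tendsto ord X l \<longleftrightarrow> (\<forall>N. \<exists>M. \<forall>i\<ge>M. ord_ge ord N (X i - l))"

(* A nonarchimedean local field: complete for a normalized discrete valuation ord, with a chosen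
   uniformizer \<pi> and with finite residue field.  The residue field has q elements, i.e. it is
   isomorphic to the field F_q. *)
locale local_field =
  fixes ord :: "'a::field \<Rightarrow> int"
    and \<pi> :: 'a
    and q :: nat
  assumes ord_mult: "\<lbrakk>x \<noteq> 0; y \<noteq> 0\<rbrakk> \<Longrightarrow> ord (x * y) = ord x + ord y"
    and ord_add: "\<lbrakk>x \<noteq> 0; y \<noteq> 0; x + y \<noteq> 0\<rbrakk> \<Longrightarrow> min (ord x) (ord y) \<le> ord (x + y)"
    and uniformizer_nonzero: "\<pi> \<noteq> 0"
    and ord_uniformizer: "ord \<pi> = 1"
    and complete: "val_Cauchy ord X \<Longrightarrow> \<exists>l. val_tendsto ord X l"
    and finite_residue_field: "finite (residue_field ord)"
    and card_residue_field: "card (residue_field ord) = q"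

(* In what follows, K is the type 'a and V is the whole type 'b, with scalar multiplication scale. *)

(* B is an O-basis of L, where O is the valuation ring. *)
definition is_O_basis ::
  "('a::field \<Rightarrow> int) \<Rightarrow> ('a \<Rightarrow> 'b::ab_group_add \<Rightarrow> 'b) \<Rightarrow> 'b set \<Rightarrow> 'b set \<Rightarrow> bool" where
  "is_O_basis ord scale B L \<longleftrightarrow> finite B \<and>
     L = {\<Sum>b\<in>B. scale (c b) b | c. \<forall>b\<in>B. c b \<in> valuation_ring ord} \<and>
     (\<forall>c. (\<forall>b\<in>B. c b \<in> valuation_ring ord) \<and> (\<Sum>b\<in>B. scale (c b) b) = 0
        \<longrightarrow> (\<forall>b\<in>B. c b = 0))"

definition is_lattice ::
  "('a::field \<Rightarrow> int) \<Rightarrow> ('a \<Rightarrow> 'b::ab_group_add \<Rightarrow> 'b) \<Rightarrow> 'b set \<Rightarrow> bool" where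
  "is_lattice ord scale L \<longleftrightarrow>
     (\<exists>B. is_O_basis ord scale B L \<and> card B = vector_space.dim scale (UNIV :: 'b set))"

definition homothety_class ::
  "('a::field \<Rightarrow> 'b::ab_group_add \<Rightarrow> 'b) \<Rightarrow> 'b set \<Rightarrow> 'b set set" where
  "homothety_class scale L = {scale \<alpha> ` L | \<alpha>. \<alpha> \<noteq> 0}"

definition vertices ::
  "('a::field \<Rightarrow> int) \<Rightarrow> ('a \<Rightarrow> 'b::ab_group_add \<Rightarrow> 'b) \<Rightarrow> 'b set set set" where
  "vertices ord scale = {homothety_class scale L | L. is_lattice ord scale L}"

(* Each vertex is incident to itself, so "pairwise incident" needs no exception for equal vertices. *)
definition incident ::
  "'a::field \<Rightarrow> ('a \<Rightarrow> 'b::ab_group_add \<Rightarrow> 'b) \<Rightarrow> 'b set set \<Rightarrow> 'b set set \<Rightarrow> bool" where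
  "incident \<pi> scale t t' \<longleftrightarrow> (\<exists>L\<in>t. \<exists>L'\<in>t'. scale \<pi> ` L \<subseteq> L' \<and> L' \<subseteq> L)"

definition simplex ::
  "('a::field \<Rightarrow> int) \<Rightarrow> 'a \<Rightarrow> ('a \<Rightarrow> 'b::ab_group_add \<Rightarrow> 'b) \<Rightarrow> 'b set set set \<Rightarrow> bool" where
  "simplex ord \<pi> scale S \<longleftrightarrow>
     finite S \<and> S \<subseteq> vertices ord scale \<and> (\<forall>t\<in>S. \<forall>t'\<in>S. incident \<pi> scale t t')"

definition chamber ::
  "('a::field \<Rightarrow> int) \<Rightarrow> 'a \<Rightarrow> ('a \<Rightarrow> 'b::ab_group_add \<Rightarrow> 'b) \<Rightarrow> 'b set set set \<Rightarrow> bool" where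
  "chamber ord \<pi> scale C \<longleftrightarrow>
     simplex ord \<pi> scale C \<and> (\<forall>S. simplex ord \<pi> scale S \<and> C \<subseteq> S \<longrightarrow> S = C)"

definition codim_one_face :: "'v set \<Rightarrow> 'v set \<Rightarrow> bool" where
  "codim_one_face F C \<longleftrightarrow> F \<subseteq> C \<and> card C = card F + 1"

definition adjacent ::
  "('a::field \<Rightarrow> int) \<Rightarrow> 'a \<Rightarrow> ('a \<Rightarrow> 'b::ab_group_add \<Rightarrow> 'b) \<Rightarrow>
     'b set set set \<Rightarrow> 'b set set set \<Rightarrow> bool" where
  "adjacent ord \<pi> scale C C' \<longleftrightarrow>
     chamber ord \<pi> scale C \<and> chamber ord \<pi> scale C' \<and>
     (\<exists>F. codim_one_face F C \<and> codim_one_face F C')"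

definition close ::
  "('a::field \<Rightarrow> int) \<Rightarrow> 'a \<Rightarrow> ('a \<Rightarrow> 'b::ab_group_add \<Rightarrow> 'b) \<Rightarrow>
     'b set set \<Rightarrow> 'b set set \<Rightarrow> bool" where
  "close ord \<pi> scale t t' \<longleftrightarrow>
     (\<exists>C C'. adjacent ord \<pi> scale C C' \<and> t \<in> C \<and> t' \<in> C' \<and> t \<notin> C \<inter> C' \<and> t' \<notin> C \<inter> C')"

end

theory Submission
  imports Defs "HOL-Library.FuncSet"
begin

text \<open>
  Write \<open>t = [L]\<close>.  A vertex incident to \<open>[B]\<close> has exactly one representative \<open>M\<close> with
  \<open>\<pi>B \<subset> M \<subseteq> B\<close>, where \<open>B\<close> represents \<open>[B]\<close> itself, and for such representatives incidence means
  comparability.  Hence the simplices containing \<open>[B]\<close> are the chains in this window that contain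
  \<open>B\<close>, and the chambers containing \<open>[B]\<close> are its maximal chains.

  If adjacent chambers differ in \<open>[L]\<close> and \<open>[M]\<close>, view both from a vertex \<open>[B]\<close> that they share.
  The two maximal chains differ in a single member, and (after rescaling) \<open>L\<close> and \<open>M\<close> lie in the
  same gap \<open>A \<subset> D\<close> of the common part.  By maximality nothing lies strictly between \<open>A\<close> and \<open>L\<close>,
  \<open>L\<close> and \<open>D\<close>, \<open>A\<close> and \<open>M\<close>, or \<open>M\<close> and \<open>D\<close>, and \<open>\<pi>D \<subseteq> A\<close> because \<open>\<pi>B \<subseteq> A\<close> and \<open>D \<subseteq> B\<close>.
  Conversely, for such \<open>A\<close> and \<open>D\<close>, replacing \<open>L\<close> by \<open>M\<close> in a maximal chain in the window of \<open>D\<close>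
  through \<open>A\<close> and \<open>L\<close> leaves it maximal.  So the vertices close to \<open>t\<close> are the classes of the
  lattices \<open>M \<noteq> L\<close> that are exchangeable with \<open>L\<close> in this sense
  (\<open>close_imp_exchangeable\<close>, \<open>exchangeable_imp_close\<close>), and distinct such \<open>M\<close> have distinct classes
  (\<open>inj_on_hclass_exchangeable\<close>).

  It remains to count the lattices \<open>M\<close>.  They determine \<open>A = L \<inter> M\<close> and \<open>D = L + M\<close>.  Over the residue
  field, \<open>A/\<pi>L\<close> is a hyperplane of the \<open>n\<close>-dimensional space \<open>L/\<pi>L\<close>, which gives
  \<open>(q ^ n - 1)/(q - 1)\<close> choices; \<open>\<pi>D/\<pi>L\<close> is a line in \<open>A/\<pi>L\<close>, which gives
  \<open>(q ^ (n - 1) - 1)/(q - 1)\<close> choices; and \<open>M/A\<close> is one of the \<open>q\<close> lines other than \<open>L/A\<close> in the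
  plane \<open>D/A\<close>.  These numbers of lines and hyperplanes are found from indices of submodules alone
  (\<open>card_lines\<close>, \<open>card_hyperplanes\<close>).  That a submodule between \<open>\<pi>L\<close> and \<open>L\<close> is again a lattice,
  so that gaps between lattices are gaps between submodules, is an exchange argument
  (\<open>lattice_between\<close>).
\<close>

section \<open>The valuation ring\<close>

context local_field
begin

abbreviation \<O> :: "'a set" where "\<O> \<equiv> valuation_ring ord"
abbreviation \<mm> :: "'a set" where "\<mm> \<equiv> maximal_ideal ord"

lemma ord_one: "ord 1 = 0"
  using ord_mult[of 1 1] by simp

lemma ord_uminus: "ord (- x) = ord x"
proof (cases "x = 0")
  case False
  have "ord (-1) = 0"
    using ord_mult[of "-1" "-1"] ord_one by simp
  then show ?thesis
    using ord_mult[of "-1" x] False by simp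
qed simp

lemma ord_inverse: "x \<noteq> 0 \<Longrightarrow> ord (inverse x) = - ord x"
  using ord_mult[of x "inverse x"] ord_one by simp

lemma ord_divide: "x \<noteq> 0 \<Longrightarrow> y \<noteq> 0 \<Longrightarrow> ord (x / y) = ord x - ord y"
  using ord_mult[of x "inverse y"] ord_inverse[of y] by (simp add: divide_inverse)

lemma in_valuation_ring: "x \<in> \<O> \<longleftrightarrow> x = 0 \<or> 0 \<le> ord x"
  by (simp add: valuation_ring_def ord_ge_def)

lemma in_maximal_ideal: "x \<in> \<mm> \<longleftrightarrow> x = 0 \<or> 1 \<le> ord x"
  by (simp add: maximal_ideal_def ord_ge_def)

lemma valuation_ring_0 [simp]: "0 \<in> \<O>" and valuation_ring_1 [simp]: "1 \<in> \<O>"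
  by (auto simp: in_valuation_ring ord_one)

lemma valuation_ring_mult: "x \<in> \<O> \<Longrightarrow> y \<in> \<O> \<Longrightarrow> x * y \<in> \<O>"
  by (cases "x = 0"; cases "y = 0") (auto simp: in_valuation_ring ord_mult)

lemma valuation_ring_add: "x \<in> \<O> \<Longrightarrow> y \<in> \<O> \<Longrightarrow> x + y \<in> \<O>"
  using ord_add[of x y] by (cases "x = 0"; cases "y = 0"; cases "x + y = 0") (auto simp: in_valuation_ring)

lemma valuation_ring_uminus: "x \<in> \<O> \<Longrightarrow> - x \<in> \<O>"
  by (auto simp: in_valuation_ring ord_uminus)

lemma valuation_ring_diff: "x \<in> \<O> \<Longrightarrow> y \<in> \<O> \<Longrightarrow> x - y \<in> \<O>"
  using valuation_ring_add[of x "- y"] valuation_ring_uminus by simp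

lemma maximal_ideal_add: "x \<in> \<mm> \<Longrightarrow> y \<in> \<mm> \<Longrightarrow> x + y \<in> \<mm>"
  using ord_add[of x y] by (cases "x = 0"; cases "y = 0"; cases "x + y = 0") (auto simp: in_maximal_ideal)

lemma maximal_ideal_uminus: "x \<in> \<mm> \<Longrightarrow> - x \<in> \<mm>"
  by (auto simp: in_maximal_ideal ord_uminus)

lemma unit_inverse: "c \<in> \<O> \<Longrightarrow> c \<notin> \<mm> \<Longrightarrow> c \<noteq> 0 \<and> inverse c \<in> \<O>"
  by (auto simp: in_valuation_ring in_maximal_ideal ord_inverse)

lemma maximal_ideal_eq: "\<mm> = (*) \<pi> ` \<O>"
proof (intro set_eqI iffI)
  fix x assume x: "x \<in> \<mm>"
  have "x = \<pi> * (x / \<pi>)"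
    using uniformizer_nonzero by simp
  moreover have "x / \<pi> \<in> \<O>"
    using x uniformizer_nonzero
    by (cases "x = 0") (auto simp: in_maximal_ideal in_valuation_ring ord_divide ord_uniformizer)
  ultimately show "x \<in> (*) \<pi> ` \<O>" by blast
next
  fix x assume "x \<in> (*) \<pi> ` \<O>"
  then obtain d where "d \<in> \<O>" "x = \<pi> * d" by blast
  then show "x \<in> \<mm>"
    using uniformizer_nonzero
    by (cases "d = 0") (auto simp: in_maximal_ideal in_valuation_ring ord_mult ord_uniformizer)
qed

definition residue_class :: "'a \<Rightarrow> 'a set" where
  "residue_class c = {d \<in> \<O>. c - d \<in> \<mm>}"

lemma residue_class_eq_iff:
  assumes "c \<in> \<O>" "d \<in> \<O>"
  shows "residue_class c = residue_class d \<longleftrightarrow> c - d \<in> \<mm>"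
proof
  assume eq: "residue_class c = residue_class d"
  have "d \<in> residue_class d"
    using assms by (simp add: residue_class_def in_maximal_ideal)
  then have "d \<in> residue_class c"
    by (simp only: eq)
  then show "c - d \<in> \<mm>"
    by (simp add: residue_class_def)
next
  assume cd: "c - d \<in> \<mm>"
  have "c - e \<in> \<mm> \<longleftrightarrow> d - e \<in> \<mm>" for e
    using maximal_ideal_add[OF cd, of "d - e"]
      maximal_ideal_add[OF maximal_ideal_uminus[OF cd], of "c - e"] by auto
  then show "residue_class c = residue_class d"
    by (simp add: residue_class_def)
qed

lemma residue_field_eq: "residue_field ord = residue_class ` \<O>"
  by (auto simp: residue_field_def quotient_def residue_class_def Image_def)

lemma q_ge_2: "2 \<le> q"
proof -
  have "residue_class 0 \<noteq> residue_class 1"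
    by (subst residue_class_eq_iff) (auto simp: in_maximal_ideal ord_uminus ord_one)
  then have "card {residue_class 0, residue_class 1} = 2" by simp
  moreover have "card {residue_class 0, residue_class 1} \<le> card (residue_field ord)"
    by (rule card_mono[OF finite_residue_field]) (simp add: residue_field_eq)
  ultimately show ?thesis
    using card_residue_field by simp
qed

end

section \<open>Submodules over the valuation ring\<close>

locale local_field_space =
  local_field ord \<pi> q + finite_dimensional_vector_space scale Basis
  for ord :: "'a::field \<Rightarrow> int" and \<pi> :: 'a and q :: nat
    and scale :: "'a \<Rightarrow> 'b::ab_group_add \<Rightarrow> 'b" (infixr "*s" 75)
    and Basis :: "'b set"
begin

abbreviation dilate :: "'a \<Rightarrow> 'b set \<Rightarrow> 'b set" (infixr "\<odot>" 75) where
  "a \<odot> M \<equiv> scale a ` M"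

definition submod :: "'b set \<Rightarrow> bool" where
  "submod M \<longleftrightarrow> 0 \<in> M \<and> (\<forall>x\<in>M. \<forall>y\<in>M. x + y \<in> M) \<and> (\<forall>c\<in>\<O>. \<forall>x\<in>M. c *s x \<in> M)"

lemma submodI:
  assumes "0 \<in> M" "\<And>x y. x \<in> M \<Longrightarrow> y \<in> M \<Longrightarrow> x + y \<in> M"
    "\<And>c x. c \<in> \<O> \<Longrightarrow> x \<in> M \<Longrightarrow> c *s x \<in> M"
  shows "submod M"
  using assms by (auto simp: submod_def)

lemma submod_0: "submod M \<Longrightarrow> 0 \<in> M"
  and submod_add: "submod M \<Longrightarrow> x \<in> M \<Longrightarrow> y \<in> M \<Longrightarrow> x + y \<in> M"
  and submod_scale: "submod M \<Longrightarrow> c \<in> \<O> \<Longrightarrow> x \<in> M \<Longrightarrow> c *s x \<in> M"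
  by (auto simp: submod_def)

lemma submod_uminus: "submod M \<Longrightarrow> x \<in> M \<Longrightarrow> - x \<in> M"
  using submod_scale[of M "-1" x] valuation_ring_uminus[of 1] by simp

lemma submod_diff: "submod M \<Longrightarrow> x \<in> M \<Longrightarrow> y \<in> M \<Longrightarrow> x - y \<in> M"
  using submod_add[of M x "- y"] submod_uminus by simp

lemma submod_sum: "submod M \<Longrightarrow> (\<And>i. i \<in> I \<Longrightarrow> f i \<in> M) \<Longrightarrow> sum f I \<in> M"
  by (induction I rule: infinite_finite_induct) (auto intro: submod_0 submod_add)

lemma submod_Int: "submod M \<Longrightarrow> submod N \<Longrightarrow> submod (M \<inter> N)"
  by (auto simp: submod_def)

lemma submod_dilate: assumes "submod M" shows "submod (a \<odot> M)"
proof (rule submodI)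
  show "0 \<in> a \<odot> M"
    using submod_0[OF assms] by (intro image_eqI[of _ _ 0]) simp_all
next
  fix x y assume "x \<in> a \<odot> M" "y \<in> a \<odot> M"
  then show "x + y \<in> a \<odot> M"
    using submod_add[OF assms] by (auto simp: scale_right_distrib[symmetric])
next
  fix c x assume c: "c \<in> \<O>" and "x \<in> a \<odot> M"
  then obtain y where "y \<in> M" "x = a *s y" by blast
  then show "c *s x \<in> a \<odot> M"
    using submod_scale[OF assms c, of y] by (intro image_eqI[of _ _ "c *s y"]) (simp_all add: mult.commute)
qed

lemma dilate_dilate: "a \<odot> b \<odot> M = (a * b) \<odot> M"
  by (auto simp: image_image)

lemma dilate_inverse [simp]:
  assumes "a \<noteq> 0"
  shows "inverse a \<odot> a \<odot> M = M" "a \<odot> inverse a \<odot> M = M"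
  using assms by (auto simp: image_image)

lemma dilate_subset_iff [simp]: "a \<noteq> 0 \<Longrightarrow> a \<odot> M \<subseteq> a \<odot> N \<longleftrightarrow> M \<subseteq> N"
  using dilate_inverse(1)[of a] by (metis image_mono)

lemma dilate_psubset_iff: "a \<noteq> 0 \<Longrightarrow> a \<odot> M \<subset> a \<odot> N \<longleftrightarrow> M \<subset> N"
  by (simp add: less_le_not_le)

lemma dilate_eq_iff [simp]: "a \<noteq> 0 \<Longrightarrow> a \<odot> M = a \<odot> N \<longleftrightarrow> M = N"
  using dilate_subset_iff by blast

lemma dilate_antimono_ord:
  assumes "submod M" "a \<noteq> 0" "b \<noteq> 0" "ord a \<le> ord b"
  shows "b \<odot> M \<subseteq> a \<odot> M"
proof -
  have "b / a \<in> \<O>"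
    using assms by (simp add: in_valuation_ring ord_divide)
  then have "(b / a) \<odot> M \<subseteq> M"
    using submod_scale[OF assms(1)] by auto
  then have "a \<odot> (b / a) \<odot> M \<subseteq> a \<odot> M" by blast
  then show ?thesis
    using assms(2) by (simp only: dilate_dilate) simp
qed

lemma dilate_unit: "submod M \<Longrightarrow> a \<noteq> 0 \<Longrightarrow> ord a = 0 \<Longrightarrow> a \<odot> M = M"
  using dilate_antimono_ord[of M a 1] dilate_antimono_ord[of M 1 a] by (simp add: ord_one subset_antisym)

lemma dilate_le_self: "submod M \<Longrightarrow> a \<noteq> 0 \<Longrightarrow> 0 \<le> ord a \<Longrightarrow> a \<odot> M \<subseteq> M"
  using dilate_antimono_ord[of M 1 a] by (simp add: ord_one)

lemma dilate_le_uniformizer: "submod M \<Longrightarrow> a \<noteq> 0 \<Longrightarrow> 1 \<le> ord a \<Longrightarrow> a \<odot> M \<subseteq> \<pi> \<odot> M"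
  using dilate_antimono_ord[of M \<pi> a] by (simp add: ord_uniformizer uniformizer_nonzero)

subsection \<open>The index of a submodule\<close>

definition cosets :: "'b set \<Rightarrow> 'b set \<Rightarrow> 'b set set" where
  "cosets P Q = (\<lambda>x. (+) x ` P) ` Q"

lemma coset_eq_iff:
  assumes "submod P"
  shows "(+) x ` P = (+) y ` P \<longleftrightarrow> x - y \<in> P"
proof
  assume eq: "(+) x ` P = (+) y ` P"
  have "x + 0 \<in> (+) x ` P"
    using submod_0[OF assms] by (rule imageI)
  then show "x - y \<in> P" by (auto simp: eq)
next
  have sub: "(+) x ` P \<subseteq> (+) y ` P" if "x - y \<in> P" for x y
  proof
    fix z assume "z \<in> (+) x ` P"
    then obtain p where "p \<in> P" "z = y + ((x - y) + p)" by auto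
    then show "z \<in> (+) y ` P"
      using submod_add[OF assms that] by blast
  qed
  assume "x - y \<in> P"
  then show "(+) x ` P = (+) y ` P"
    using sub[of x y] sub[of y x] submod_uminus[OF assms, of "x - y"] by auto
qed

text \<open>Two maps with the same kernel have images in bijection; so quotients of one set by one relation,
  presented by different maps, can be compared without choosing representatives.\<close>

lemma card_image_same_kernel:
  assumes "\<And>x y. x \<in> A \<Longrightarrow> y \<in> A \<Longrightarrow> f x = f y \<longleftrightarrow> g x = g y"
  shows "card (f ` A) = card (g ` A)" "finite (f ` A) \<longleftrightarrow> finite (g ` A)"
proof -
  define k where "k z = g (SOME x. x \<in> A \<and> f x = z)" for z
  have k: "k (f x) = g x" if "x \<in> A" for x
  proof -
    have "(SOME y. y \<in> A \<and> f y = f x) \<in> A \<and> f (SOME y. y \<in> A \<and> f y = f x) = f x"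
      by (rule someI[of _ x]) (simp add: that)
    then show ?thesis
      unfolding k_def using assms that by blast
  qed
  have "bij_betw k (f ` A) (g ` A)"
    unfolding bij_betw_def inj_on_def using k assms by (auto simp: image_image)
  then show "card (f ` A) = card (g ` A)" "finite (f ` A) \<longleftrightarrow> finite (g ` A)"
    by (auto simp: bij_betw_same_card bij_betw_finite)
qed

lemma cosets_eq_1:
  assumes "submod P" "submod Q" "P \<subseteq> Q" "card (cosets P Q) = 1"
  shows "P = Q"
proof -
  have "x \<in> P" if "x \<in> Q" for x
  proof -
    have "(+) x ` P \<in> cosets P Q" "(+) 0 ` P \<in> cosets P Q"
      using that submod_0[OF assms(2)] unfolding cosets_def by blast+
    then have "(+) x ` P = (+) 0 ` P"
      using assms(4) by (auto simp: card_1_singleton_iff)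
    then show ?thesis
      using coset_eq_iff[OF assms(1), of x 0] by simp
  qed
  then show ?thesis using assms(3) by blast
qed

lemma finite_cosets_subset: "finite (cosets P R) \<Longrightarrow> Q \<subseteq> R \<Longrightarrow> finite (cosets P Q)"
  unfolding cosets_def by (rule finite_subset[OF image_mono])

text \<open>The map \<open>x + P \<mapsto> x + Q\<close>, that is \<open>Z \<mapsto> Z + Q\<close>, sends the cosets of \<open>P\<close> in \<open>R\<close> onto those of \<open>Q\<close>,
  and the fibre over \<open>r + Q\<close> is the translate by \<open>r\<close> of the cosets of \<open>P\<close> in \<open>Q\<close>.\<close>

lemma card_cosets_mult:
  assumes P: "submod P" and Q: "submod Q" and R: "submod R" and le: "P \<subseteq> Q" "Q \<subseteq> R"
    and fin: "finite (cosets P R)"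
  shows "card (cosets P Q) * card (cosets Q R) = card (cosets P R)" "finite (cosets Q R)"
proof -
  define f where "f Z = (\<lambda>(x, y). x + y) ` (Z \<times> Q)" for Z :: "'b set"
  have f: "f ((+) x ` P) = (+) x ` Q" for x
  proof (intro set_eqI iffI)
    fix z assume "z \<in> f ((+) x ` P)"
    then obtain p y where "p \<in> P" "y \<in> Q" "z = x + (p + y)"
      by (auto simp: f_def algebra_simps)
    moreover from this have "p + y \<in> Q"
      using le submod_add[OF Q] by blast
    ultimately show "z \<in> (+) x ` Q" by blast
  next
    fix z assume "z \<in> (+) x ` Q"
    then obtain y where y: "y \<in> Q" "z = (x + 0) + y" by auto
    show "z \<in> f ((+) x ` P)"
      unfolding f_def using y submod_0[OF P] by (intro image_eqI[of _ _ "(x + 0, y)"]) auto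
  qed
  have img: "f ` cosets P R = cosets Q R"
    unfolding cosets_def by (simp add: image_image f)
  then show fin': "finite (cosets Q R)"
    using fin by (metis finite_imageI)
  have fibre: "card {Z \<in> cosets P R. f Z = W} = card (cosets P Q)" if W: "W \<in> cosets Q R" for W
  proof -
    obtain r where r: "r \<in> R" "W = (+) r ` Q"
      using W unfolding cosets_def by blast
    have "{Z \<in> cosets P R. f Z = W} = (\<lambda>y. (+) (r + y) ` P) ` Q"
    proof (intro set_eqI iffI)
      fix Z assume "Z \<in> {Z \<in> cosets P R. f Z = W}"
      then obtain x where x: "x \<in> R" "Z = (+) x ` P" "(+) x ` Q = (+) r ` Q"
        using f r by (auto simp: cosets_def)
      then have "x - r \<in> Q"
        using coset_eq_iff[OF Q] by blast
      then show "Z \<in> (\<lambda>y. (+) (r + y) ` P) ` Q"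
        using x by (intro image_eqI[of _ _ "x - r"]) simp_all
    next
      fix Z assume "Z \<in> (\<lambda>y. (+) (r + y) ` P) ` Q"
      then obtain y where y: "y \<in> Q" "Z = (+) (r + y) ` P" by blast
      have "r + y \<in> R"
        using r y le submod_add[OF R] by blast
      moreover have "f Z = W"
        unfolding y f r coset_eq_iff[OF Q] using y by simp
      ultimately show "Z \<in> {Z \<in> cosets P R. f Z = W}"
        using y by (auto simp: cosets_def)
    qed
    then show ?thesis
      unfolding cosets_def
      by simp (rule card_image_same_kernel, simp add: coset_eq_iff[OF P])
  qed
  have "card (cosets P R) = (\<Sum>W\<in>cosets Q R. card {Z \<in> cosets P R. f Z = W})"
    using sum.image_gen[OF fin, of "\<lambda>_. 1::nat" f] img by simp
  also have "\<dots> = card (cosets P Q) * card (cosets Q R)"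
    by (simp add: fibre)
  finally show "card (cosets P Q) * card (cosets Q R) = card (cosets P R)" ..
qed

text \<open>A submodule containing \<open>P\<close> is the union of its cosets of \<open>P\<close>.\<close>

lemma finite_intermediate_submods:
  assumes "submod P" "finite (cosets P Q)"
  shows "finite {M. submod M \<and> P \<subseteq> M \<and> M \<subseteq> Q}"
proof (rule finite_subset)
  show "{M. submod M \<and> P \<subseteq> M \<and> M \<subseteq> Q} \<subseteq> Union ` Pow (cosets P Q)"
  proof
    fix M assume M: "M \<in> {M. submod M \<and> P \<subseteq> M \<and> M \<subseteq> Q}"
    then have "M = \<Union> (cosets P M)"
      using submod_0[OF assms(1)] by (force simp: cosets_def dest: submod_add)
    moreover have "cosets P M \<subseteq> cosets P Q"
      using M by (auto simp: cosets_def)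
    ultimately show "M \<in> Union ` Pow (cosets P Q)" by blast
  qed
qed (use assms in simp)

end

context local_field_space
begin

subsection \<open>Covers\<close>

definition covered_by :: "'b set \<Rightarrow> 'b set \<Rightarrow> bool" (infix "\<lhd>" 50) where
  "P \<lhd> E \<longleftrightarrow> submod P \<and> submod E \<and> P \<subset> E \<and>
     (\<forall>M. submod M \<and> P \<subseteq> M \<and> M \<subseteq> E \<longrightarrow> M = P \<or> M = E)"

lemma covered_byD:
  assumes "P \<lhd> E"
  shows "submod P" "submod E" "P \<subset> E" "P \<subseteq> E"
    "\<And>M. submod M \<Longrightarrow> P \<subseteq> M \<Longrightarrow> M \<subseteq> E \<Longrightarrow> M = P \<or> M = E"
  using assms by (auto simp: covered_by_def)

lemma dilate_covered_by:
  assumes "a \<noteq> 0" "P \<lhd> E"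
  shows "a \<odot> P \<lhd> a \<odot> E"
  unfolding covered_by_def
proof (intro conjI allI impI)
  show "submod (a \<odot> P)" "submod (a \<odot> E)" "a \<odot> P \<subset> a \<odot> E"
    using covered_byD[OF assms(2)] assms(1) by (simp_all add: submod_dilate dilate_psubset_iff)
  fix M assume M: "submod M \<and> a \<odot> P \<subseteq> M \<and> M \<subseteq> a \<odot> E"
  have "P \<subseteq> inverse a \<odot> M" "inverse a \<odot> M \<subseteq> E"
    using M assms(1) dilate_inverse(2)[of a M] dilate_subset_iff[of a] by metis+
  then have "inverse a \<odot> M = P \<or> inverse a \<odot> M = E"
    using covered_byD(5)[OF assms(2), of "inverse a \<odot> M"] M submod_dilate[of M "inverse a"] by simp
  then show "M = a \<odot> P \<or> M = a \<odot> E"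
    using dilate_inverse(2)[OF assms(1), of M] by auto
qed

lemma dilate_covered_by_iff: "a \<noteq> 0 \<Longrightarrow> a \<odot> P \<lhd> a \<odot> E \<longleftrightarrow> P \<lhd> E"
  using dilate_covered_by[of a P E] dilate_covered_by[of "inverse a" "a \<odot> P" "a \<odot> E"] by auto

definition adjoin :: "'b set \<Rightarrow> 'b \<Rightarrow> 'b set" where
  "adjoin P x = {p + c *s x | p c. p \<in> P \<and> c \<in> \<O>}"

lemma submod_adjoin:
  assumes "submod P"
  shows "submod (adjoin P x)"
proof (rule submodI)
  show "0 \<in> adjoin P x"
    unfolding adjoin_def using submod_0[OF assms] valuation_ring_0
    by (intro CollectI exI[of _ 0]) simp
next
  fix y z assume "y \<in> adjoin P x" "z \<in> adjoin P x"
  then obtain p c p' c' where "p \<in> P" "c \<in> \<O>" "y = p + c *s x"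
    and "p' \<in> P" "c' \<in> \<O>" "z = p' + c' *s x"
    unfolding adjoin_def by blast
  then have "y + z = (p + p') + (c + c') *s x" "p + p' \<in> P" "c + c' \<in> \<O>"
    by (auto simp: scale_left_distrib valuation_ring_add submod_add[OF assms])
  then show "y + z \<in> adjoin P x"
    unfolding adjoin_def by blast
next
  fix d y assume d: "d \<in> \<O>" and "y \<in> adjoin P x"
  then obtain p c where "p \<in> P" "c \<in> \<O>" "y = p + c *s x"
    unfolding adjoin_def by blast
  then have "d *s y = d *s p + (d * c) *s x" "d *s p \<in> P" "d * c \<in> \<O>"
    using d by (auto simp: scale_right_distrib valuation_ring_mult submod_scale[OF assms])
  then show "d *s y \<in> adjoin P x"
    unfolding adjoin_def by blast
qed

lemma subset_adjoin: "P \<subseteq> adjoin P x"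
proof
  fix p assume "p \<in> P"
  moreover have "p = p + 0 *s x" by simp
  ultimately show "p \<in> adjoin P x"
    unfolding adjoin_def using valuation_ring_0 by blast
qed

lemma in_adjoin: "submod P \<Longrightarrow> x \<in> adjoin P x"
proof -
  assume "submod P"
  moreover have "x = 0 + 1 *s x" by simp
  ultimately show ?thesis
    unfolding adjoin_def using submod_0 valuation_ring_1 by blast
qed

lemma adjoin_least: "submod M \<Longrightarrow> P \<subseteq> M \<Longrightarrow> x \<in> M \<Longrightarrow> adjoin P x \<subseteq> M"
  unfolding adjoin_def by (auto intro!: submod_add submod_scale)

text \<open>The annihilator of a nonzero \<open>x\<close> in a quotient killed by \<open>\<pi>\<close> is the maximal ideal, because units
  can be cancelled.  So \<open>adjoin P x\<close> is a line over the residue field modulo \<open>P\<close>; this gives both the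
  covering property and the index in the next two lemmas.\<close>

lemma scale_mem_iff_maximal_ideal:
  assumes P: "submod P" and x: "x \<notin> P" "\<pi> *s x \<in> P" and c: "c \<in> \<O>"
  shows "c *s x \<in> P \<longleftrightarrow> c \<in> \<mm>"
proof
  assume cx: "c *s x \<in> P"
  show "c \<in> \<mm>"
  proof (rule ccontr)
    assume "c \<notin> \<mm>"
    then have "inverse c *s c *s x \<in> P" and "c \<noteq> 0"
      using unit_inverse[OF c] submod_scale[OF P _ cx] by blast+
    then show False using x by simp
  qed
next
  assume "c \<in> \<mm>"
  then obtain d where "d \<in> \<O>" "c = \<pi> * d"
    unfolding maximal_ideal_eq by blast
  then show "c *s x \<in> P"
    using submod_scale[OF P _ x(2), of d] by (simp add: mult.commute)
qed

lemma covered_by_adjoin: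
  assumes P: "submod P" and x: "x \<notin> P" "\<pi> *s x \<in> P"
  shows "P \<lhd> adjoin P x"
  unfolding covered_by_def
proof (intro conjI allI impI)
  show "P \<subset> adjoin P x"
    using subset_adjoin[of P x] in_adjoin[OF P, of x] x by blast
  fix M assume M: "submod M \<and> P \<subseteq> M \<and> M \<subseteq> adjoin P x"
  show "M = P \<or> M = adjoin P x"
  proof (cases "M \<subseteq> P")
    case False
    then obtain y where y: "y \<in> M" "y \<notin> P" by blast
    then obtain p c where pc: "p \<in> P" "c \<in> \<O>" "y = p + c *s x"
      using M unfolding adjoin_def by blast
    have "c *s x = y - p"
      using pc by simp
    then have cx: "c *s x \<in> M"
      using submod_diff[of M y p] M y pc by auto
    have "c *s x \<notin> P"
      using y pc submod_add[OF P] by auto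
    then have u: "c \<noteq> 0" "inverse c \<in> \<O>"
      using scale_mem_iff_maximal_ideal[OF P x pc(2)] unit_inverse pc(2) by auto
    then have "inverse c *s c *s x \<in> M"
      using M cx submod_scale by blast
    then have "x \<in> M"
      using u by simp
    then show ?thesis
      using adjoin_least[of M P x] M by blast
  qed (use M in blast)
qed (use P submod_adjoin in auto)

lemma card_cosets_adjoin:
  assumes P: "submod P" and x: "x \<notin> P" "\<pi> *s x \<in> P"
  shows "card (cosets P (adjoin P x)) = q"
proof -
  have "cosets P (adjoin P x) = (\<lambda>c. (+) (c *s x) ` P) ` \<O>"
  proof (intro set_eqI iffI)
    fix Z assume "Z \<in> cosets P (adjoin P x)"
    then obtain p c where *: "p \<in> P" "c \<in> \<O>" "Z = (+) (p + c *s x) ` P"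
      unfolding cosets_def adjoin_def by blast
    then have "Z = (+) (c *s x) ` P"
      using coset_eq_iff[OF P, of "p + c *s x" "c *s x"] by simp
    then show "Z \<in> (\<lambda>c. (+) (c *s x) ` P) ` \<O>"
      using * by blast
  next
    fix Z assume "Z \<in> (\<lambda>c. (+) (c *s x) ` P) ` \<O>"
    then obtain c where "c \<in> \<O>" "Z = (+) (c *s x) ` P" by blast
    then show "Z \<in> cosets P (adjoin P x)"
      unfolding cosets_def
      using submod_scale[OF submod_adjoin[OF P] _ in_adjoin[OF P]] by blast
  qed
  moreover have "card ((\<lambda>c. (+) (c *s x) ` P) ` \<O>) = card (residue_class ` \<O>)"
  proof (rule card_image_same_kernel)
    fix c d assume cd: "c \<in> \<O>" "d \<in> \<O>"
    have "(+) (c *s x) ` P = (+) (d *s x) ` P \<longleftrightarrow> (c - d) *s x \<in> P"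
      by (simp add: coset_eq_iff[OF P] scale_left_diff_distrib)
    then show "(+) (c *s x) ` P = (+) (d *s x) ` P \<longleftrightarrow> residue_class c = residue_class d"
      using scale_mem_iff_maximal_ideal[OF P x] cd
      by (simp add: residue_class_eq_iff valuation_ring_diff)
  qed
  ultimately show ?thesis
    using card_residue_field by (simp add: residue_field_eq)
qed

lemma covered_by_eq_adjoin:
  assumes "P \<lhd> E" "x \<in> E" "x \<notin> P"
  shows "E = adjoin P x"
proof -
  have "adjoin P x = P \<or> adjoin P x = E"
    using covered_byD[OF assms(1)] submod_adjoin subset_adjoin adjoin_least assms(2) by metis
  then show ?thesis
    using in_adjoin[of P x] covered_byD(1)[OF assms(1)] assms(3) by blast
qed

lemma card_cosets_covered_by:
  assumes "P \<lhd> E" "\<pi> \<odot> E \<subseteq> P"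
  shows "card (cosets P E) = q"
proof -
  obtain x where "x \<in> E" "x \<notin> P"
    using covered_byD(3)[OF assms(1)] by blast
  then show ?thesis
    using covered_by_eq_adjoin[OF assms(1)] card_cosets_adjoin[of P x] covered_byD[OF assms(1)] assms(2)
    by auto
qed

lemma covered_by_if_card_cosets:
  assumes P: "submod P" and Q: "submod Q" and le: "P \<subseteq> Q" "\<pi> \<odot> Q \<subseteq> P"
    and card: "card (cosets P Q) = q"
  shows "P \<lhd> Q"
proof -
  have fin: "finite (cosets P Q)"
    using card q_ge_2 by (intro card_ge_0_finite) simp
  have "P \<noteq> Q"
  proof
    assume "P = Q"
    then have "cosets P Q = {P}"
      using coset_eq_iff[OF P, of _ 0] submod_0[OF P] by (auto simp: cosets_def image_iff)
    then show False using card q_ge_2 by simp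
  qed
  then obtain x where x: "x \<in> Q" "x \<notin> P" "\<pi> *s x \<in> P"
    using le by blast
  have "q * card (cosets (adjoin P x) Q) = q"
    using card_cosets_mult(1)[OF P submod_adjoin[OF P] Q subset_adjoin adjoin_least[OF Q le(1) x(1)] fin]
    by (simp add: card card_cosets_adjoin[OF P x(2,3)])
  then have "card (cosets (adjoin P x) Q) = 1"
    using q_ge_2 by simp
  then have "adjoin P x = Q"
    by (intro cosets_eq_1 submod_adjoin P Q adjoin_least le x)
  then show ?thesis
    using covered_by_adjoin[OF P x(2,3)] by simp
qed

subsection \<open>Counting lines and hyperplanes\<close>

text \<open>Each nonzero coset \<open>x + P\<close> in \<open>Q\<close> lies in exactly one cover of \<open>P\<close>, namely \<open>adjoin P x\<close>, and each
  cover contains \<open>q - 1\<close> nonzero cosets.\<close>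

lemma card_lines:
  assumes P: "submod P" and Q: "submod Q" and le: "P \<subseteq> Q" "\<pi> \<odot> Q \<subseteq> P"
    and fin: "finite (cosets P Q)"
  shows "card {E. P \<lhd> E \<and> E \<subseteq> Q} * (q - 1) + 1 = card (cosets P Q)"
    and "finite {E. P \<lhd> E \<and> E \<subseteq> Q}"
proof -
  let ?L = "{E. P \<lhd> E \<and> E \<subseteq> Q}"
  show finL: "finite ?L"
    by (rule finite_subset[OF _ finite_intermediate_submods[OF P fin]]) (auto dest: covered_byD)
  have P_in: "P \<in> cosets P M" if "submod M" for M
    unfolding cosets_def using submod_0[OF that] by (intro image_eqI[of _ _ 0]) simp_all
  have nonzero: "(+) x ` P = P \<longleftrightarrow> x \<in> P" for x
    using coset_eq_iff[OF P, of x 0] by simp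
  have "cosets P Q - {P} = (\<Union>E\<in>?L. cosets P E - {P})"
  proof (intro set_eqI iffI)
    fix Z assume "Z \<in> cosets P Q - {P}"
    then obtain x where x: "x \<in> Q" "Z = (+) x ` P" "x \<notin> P"
      unfolding cosets_def using nonzero by blast
    then have "P \<lhd> adjoin P x"
      using covered_by_adjoin[OF P] le by blast
    moreover have "adjoin P x \<subseteq> Q"
      using adjoin_least[OF Q le(1) x(1)] .
    moreover have "Z \<in> cosets P (adjoin P x) - {P}"
      unfolding cosets_def using x nonzero in_adjoin[OF P] by blast
    ultimately show "Z \<in> (\<Union>E\<in>?L. cosets P E - {P})" by blast
  next
    fix Z assume "Z \<in> (\<Union>E\<in>?L. cosets P E - {P})"
    then show "Z \<in> cosets P Q - {P}"
      unfolding cosets_def by blast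
  qed
  moreover have "card (\<Union>E\<in>?L. cosets P E - {P}) = (\<Sum>E\<in>?L. card (cosets P E - {P}))"
  proof (rule card_UN_disjoint[OF finL])
    show "\<forall>E\<in>?L. finite (cosets P E - {P})"
      using finite_cosets_subset[OF fin] by blast
    show "\<forall>E\<in>?L. \<forall>E'\<in>?L. E \<noteq> E' \<longrightarrow> (cosets P E - {P}) \<inter> (cosets P E' - {P}) = {}"
    proof (intro ballI impI, rule ccontr)
      fix E E' assume E: "E \<in> ?L" "E' \<in> ?L" "E \<noteq> E'"
        and "(cosets P E - {P}) \<inter> (cosets P E' - {P}) \<noteq> {}"
      then obtain x y where xy: "x \<in> E" "y \<in> E'" "(+) x ` P = (+) y ` P" "(+) x ` P \<noteq> P"
        unfolding cosets_def by blast
      then have "x - y \<in> P" "x \<notin> P"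
        using coset_eq_iff[OF P] nonzero by auto
      moreover have "x = (x - y) + y" by simp
      ultimately have "x \<in> E'"
        using E(2) xy(2) submod_add[of E' "x - y" y] covered_byD(2,4)[of P E'] by auto
      then show False
        using covered_by_eq_adjoin[of P E x] covered_by_eq_adjoin[of P E' x] E xy(1) \<open>x \<notin> P\<close> by auto
    qed
  qed
  moreover have "card (cosets P E - {P}) = q - 1" if E: "E \<in> ?L" for E
  proof -
    have "\<pi> \<odot> E \<subseteq> P"
      using E le by blast
    then have "card (cosets P E) = q"
      using card_cosets_covered_by E by blast
    then show ?thesis
      using P_in[of E] covered_byD(2)[of P E] E q_ge_2
      by (simp add: card_Diff_singleton)
  qed
  moreover have "card (cosets P Q) = card (cosets P Q - {P}) + 1"
    using card_Suc_Diff1[OF fin P_in[OF Q]] by simp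
  ultimately show "card ?L * (q - 1) + 1 = card (cosets P Q)"
    by simp
qed

text \<open>Counting pairs of a line \<open>E\<close> and a hyperplane \<open>H \<supseteq> E\<close> in two ways avoids duality.  The lines in \<open>H\<close>
  are counted by \<open>card_lines\<close>, the hyperplanes through \<open>E\<close> by induction, and both numbers are
  \<open>(q ^ d - 1)/(q - 1)\<close> in dimension \<open>d + 1\<close>.  Hence there are as many hyperplanes as lines.\<close>

lemma card_hyperplanes:
  assumes "submod P" "submod Q" "P \<subseteq> Q" "\<pi> \<odot> Q \<subseteq> P" "card (cosets P Q) = q ^ d"
  shows "card {H. P \<subseteq> H \<and> H \<lhd> Q} * (q - 1) + 1 = q ^ d"
  using assms
proof (induction d arbitrary: P)
  case 0
  then have "P = Q"
    using cosets_eq_1 by simp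
  then have "{H. P \<subseteq> H \<and> H \<lhd> Q} = {}"
    using covered_byD(3) by blast
  then show ?case by (simp only: card.empty) simp
next
  case (Suc d)
  note P = Suc.prems(1) and Q = Suc.prems(2) and le = Suc.prems(3,4)
  have fin: "finite (cosets P Q)"
    using Suc.prems(5) q_ge_2 by (intro card_ge_0_finite) simp
  \<comment> \<open>In dimension 1 no line lies in a hyperplane, so the double count only says \<open>0 = 0\<close>.\<close>
  show ?case
  proof (cases "d = 0")
    case True
    then have PQ: "P \<lhd> Q"
      using covered_by_if_card_cosets[OF P Q le] Suc.prems(5) by simp
    have "{H. P \<subseteq> H \<and> H \<lhd> Q} = {P}"
    proof (intro set_eqI iffI)
      fix H assume "H \<in> {H. P \<subseteq> H \<and> H \<lhd> Q}"
      then show "H \<in> {P}"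
        using covered_byD(5)[OF PQ, of H] covered_byD(1,3,4)[of H Q] by auto
    qed (use PQ in auto)
    then show ?thesis
      using True q_ge_2 by simp
  next
    case False
    let ?L = "{E. P \<lhd> E \<and> E \<subseteq> Q}" and ?H = "{H. P \<subseteq> H \<and> H \<lhd> Q}"
    have lines: "card ?L * (q - 1) + 1 = q ^ Suc d" and finL: "finite ?L"
      using card_lines[OF P Q le fin] Suc.prems(5) by auto
    have finH: "finite ?H"
      by (rule finite_subset[OF _ finite_intermediate_submods[OF P fin]]) (auto dest: covered_byD)
    have through: "card {H \<in> ?H. E \<subseteq> H} * (q - 1) + 1 = q ^ d" if E: "E \<in> ?L" for E
    proof -
      have sE: "submod E" and PE: "P \<subseteq> E" "E \<subseteq> Q"
        using E covered_byD[of P E] by auto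
      have piE: "\<pi> \<odot> E \<subseteq> P" "\<pi> \<odot> Q \<subseteq> E"
        using le PE by blast+
      have "q * card (cosets E Q) = q ^ Suc d"
        using card_cosets_mult(1)[OF P sE Q PE fin] card_cosets_covered_by[of P E] E piE Suc.prems(5)
        by simp
      then have "card (cosets E Q) = q ^ d"
        using q_ge_2 by simp
      then have "card {H. E \<subseteq> H \<and> H \<lhd> Q} * (q - 1) + 1 = q ^ d"
        using Suc.IH[OF sE Q PE(2) piE(2)] by simp
      moreover have "{H \<in> ?H. E \<subseteq> H} = {H. E \<subseteq> H \<and> H \<lhd> Q}"
        using PE by blast
      ultimately show ?thesis
        by simp
    qed
    have inside: "card {E \<in> ?L. E \<subseteq> H} * (q - 1) + 1 = q ^ d" if H: "H \<in> ?H" for H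
    proof -
      have sH: "submod H" and PH: "P \<subseteq> H" "H \<subseteq> Q"
        using H covered_byD[of H Q] by auto
      have piH: "\<pi> \<odot> H \<subseteq> P" "\<pi> \<odot> Q \<subseteq> H"
        using le PH by blast+
      have "card (cosets P H) * q = q ^ Suc d"
        using card_cosets_mult(1)[OF P sH Q PH fin] card_cosets_covered_by[of H Q] H piH Suc.prems(5)
        by simp
      then have "card (cosets P H) = q ^ d"
        using q_ge_2 by simp
      then have "card {E. P \<lhd> E \<and> E \<subseteq> H} * (q - 1) + 1 = q ^ d"
        using card_lines(1)[OF P sH PH(1) piH(1) finite_cosets_subset[OF fin PH(2)]] by simp
      moreover have "{E \<in> ?L. E \<subseteq> H} = {E. P \<lhd> E \<and> E \<subseteq> H}"
        using PH by blast
      ultimately show ?thesis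
        by simp
    qed
    have one_less: "1 < q ^ k" if "k \<noteq> 0" for k
      using that q_ge_2 by (intro one_less_power) simp_all
    have "?L \<noteq> {}"
    proof
      assume "?L = {}"
      then have "1 = q ^ Suc d"
        using lines by (simp only: card.empty)
      then show False
        using one_less[of "Suc d"] by simp
    qed
    then obtain E where E: "E \<in> ?L" by blast
    define m where "m = card {H \<in> ?H. E \<subseteq> H}"
    have m: "m * (q - 1) + 1 = q ^ d"
      unfolding m_def using through[OF E] .
    have m_unique: "k = m" if "k * (q - 1) + 1 = q ^ d" for k
    proof -
      have "k * (q - 1) = m * (q - 1)"
        using that m by linarith
      then show ?thesis
        using q_ge_2 by simp
    qed
    have "m \<noteq> 0"
      using m one_less[OF False] by (intro notI) simp
    have "(\<Sum>E\<in>?L. card {H \<in> ?H. E \<subseteq> H}) = m * card ?H"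
      by (rule sum_multicount[OF finL finH]) (use inside m_unique in blast)
    moreover have "(\<Sum>E\<in>?L. card {H \<in> ?H. E \<subseteq> H}) = (\<Sum>E\<in>?L. m)"
      by (rule sum.cong) (use through m_unique in blast)+
    ultimately have "card ?H = card ?L"
      using \<open>m \<noteq> 0\<close> by simp
    then show ?thesis
      using lines by simp
  qed
qed

end

section \<open>Lattices\<close>

context local_field_space
begin

abbreviation lattice :: "'b set \<Rightarrow> bool" where "lattice \<equiv> is_lattice ord scale"

definition ospan :: "'b set \<Rightarrow> 'b set" where
  "ospan B = {\<Sum>b\<in>B. c b *s b | c. \<forall>b\<in>B. c b \<in> \<O>}"

lemma submod_ospan: "submod (ospan B)"
proof (rule submodI)
  show "0 \<in> ospan B"
    unfolding ospan_def by (intro CollectI exI[of _ "\<lambda>_. 0"]) simp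
next
  fix x y assume "x \<in> ospan B" "y \<in> ospan B"
  then obtain c d where "\<forall>b\<in>B. c b \<in> \<O>" "x = (\<Sum>b\<in>B. c b *s b)"
    and "\<forall>b\<in>B. d b \<in> \<O>" "y = (\<Sum>b\<in>B. d b *s b)"
    unfolding ospan_def by blast
  then show "x + y \<in> ospan B"
    unfolding ospan_def
    by (intro CollectI exI[of _ "\<lambda>b. c b + d b"])
      (simp add: scale_left_distrib sum.distrib valuation_ring_add)
next
  fix a x assume a: "a \<in> \<O>" and "x \<in> ospan B"
  then obtain c where "\<forall>b\<in>B. c b \<in> \<O>" "x = (\<Sum>b\<in>B. c b *s b)"
    unfolding ospan_def by blast
  then show "a *s x \<in> ospan B"
    unfolding ospan_def using a
    by (intro CollectI exI[of _ "\<lambda>b. a * c b"]) (simp add: scale_sum_right valuation_ring_mult)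
qed

lemma ospan_least: "submod M \<Longrightarrow> B \<subseteq> M \<Longrightarrow> ospan B \<subseteq> M"
  unfolding ospan_def by (auto intro!: submod_sum submod_scale)

lemma ospan_base:
  assumes "finite B" "b \<in> B"
  shows "b \<in> ospan B"
proof -
  have "(\<Sum>x\<in>B. (if x = b then 1 else 0) *s x) = (\<Sum>x\<in>B. if x = b then x else 0)"
    by (rule sum.cong) simp_all
  also have "\<dots> = b"
    using assms by simp
  finally show ?thesis
    unfolding ospan_def by (intro CollectI exI[of _ "\<lambda>x. if x = b then 1 else 0"]) simp
qed

text \<open>Used to turn a linear relation over the field into one over the valuation ring.\<close>

lemma clear_denominators:
  assumes "finite B"
  shows "\<exists>a. a \<noteq> 0 \<and> a \<in> \<O> \<and> (\<forall>b\<in>B. a * u b \<in> \<O>)"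
  using assms
proof (induction B)
  case empty
  show ?case by (rule exI[of _ 1]) simp
next
  case (insert b B)
  then obtain a where a: "a \<noteq> 0" "a \<in> \<O>" "\<forall>b\<in>B. a * u b \<in> \<O>" by blast
  obtain a' where a': "a' \<noteq> 0" "a' \<in> \<O>" "a' * u b \<in> \<O>"
  proof (cases "u b \<in> \<O>")
    case True
    then show ?thesis using that[of 1] by simp
  next
    case False
    then have "u b \<noteq> 0" "inverse (u b) \<in> \<O>"
      by (auto simp: in_valuation_ring ord_inverse)
    then show ?thesis using that[of "inverse (u b)"] by simp
  qed
  have "a' * a * u x \<in> \<O>" if "x \<in> insert b B" for x
  proof (cases "x = b")
    case True
    have "a' * a * u x = a * (a' * u b)"
      using True by simp
    then show ?thesis
      using a a' by (simp only: valuation_ring_mult)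
  next
    case False
    then have "a * u x \<in> \<O>" using that a by blast
    then show ?thesis
      using a' valuation_ring_mult[of a' "a * u x"] by (simp only: mult.assoc)
  qed
  then show ?case
    using a a' by (intro exI[of _ "a' * a"]) (simp add: valuation_ring_mult)
qed

lemma lattice_iff:
  "lattice L \<longleftrightarrow> (\<exists>B. finite B \<and> independent B \<and> card B = dim UNIV \<and> L = ospan B)"
proof
  assume "lattice L"
  then obtain B where B: "finite B" "L = ospan B" "card B = dim UNIV"
    and ind: "\<And>c. (\<forall>b\<in>B. c b \<in> \<O>) \<and> (\<Sum>b\<in>B. c b *s b) = 0 \<Longrightarrow> \<forall>b\<in>B. c b = 0"
    unfolding is_lattice_def is_O_basis_def ospan_def by blast
  have "independent B"
  proof
    assume "dependent B"
    then obtain u where u: "\<exists>v\<in>B. u v \<noteq> 0" "(\<Sum>v\<in>B. u v *s v) = 0"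
      using dependent_finite[OF B(1)] by blast
    obtain a where a: "a \<noteq> 0" "\<forall>b\<in>B. a * u b \<in> \<O>"
      using clear_denominators[OF B(1)] by blast
    have "(\<Sum>v\<in>B. (a * u v) *s v) = a *s (\<Sum>v\<in>B. u v *s v)"
      by (simp add: scale_sum_right)
    then have "\<forall>b\<in>B. a * u b = 0"
      using ind[of "\<lambda>b. a * u b"] a u by simp
    then show False
      using a u by auto
  qed
  then show "\<exists>B. finite B \<and> independent B \<and> card B = dim UNIV \<and> L = ospan B"
    using B by blast
next
  assume "\<exists>B. finite B \<and> independent B \<and> card B = dim UNIV \<and> L = ospan B"
  then obtain B where "finite B" "independent B" "card B = dim UNIV" "L = ospan B" by blast
  then show "lattice L"
    unfolding is_lattice_def is_O_basis_def ospan_def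
    using dependent_finite[of B] by (intro exI[of _ B]) blast
qed

lemma submod_lattice: "lattice L \<Longrightarrow> submod L"
  using submod_ospan by (auto simp: lattice_iff)

text \<open>In the right cardinality it is enough to span a known basis.\<close>

lemma basis_if_spanning:
  assumes "finite B" "B \<subseteq> span C" "span B = UNIV" "card C = dim UNIV" "finite C"
  shows "independent C"
proof -
  have "UNIV \<subseteq> span C"
    using span_minimal[OF assms(2) subspace_span] assms(3) by simp
  then show ?thesis
    using card_eq_dim[of C UNIV] assms by auto
qed

lemma span_basis: "finite B \<Longrightarrow> independent B \<Longrightarrow> card B = dim UNIV \<Longrightarrow> span B = UNIV"
  using card_eq_dim[of B UNIV] by auto

lemma lattice_dilate:
  assumes "lattice L" "a \<noteq> 0"
  shows "lattice (a \<odot> L)"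
proof -
  obtain B where B: "finite B" "independent B" "card B = dim UNIV" "L = ospan B"
    using assms(1) by (auto simp: lattice_iff)
  have inj: "inj_on (scale a) B"
    using assms(2) by (intro inj_onI) simp
  have "b \<in> span (a \<odot> B)" if "b \<in> B" for b
    using span_scale[OF span_base[of "a *s b" "a \<odot> B"], of "inverse a"] that assms(2) by simp
  then have "independent (a \<odot> B)"
    using B span_basis[of B] card_image[OF inj] by (intro basis_if_spanning[of B]) auto
  moreover have "a \<odot> L = ospan (a \<odot> B)"
  proof
    have "a *s b \<in> ospan (a \<odot> B)" if "b \<in> B" for b
      using ospan_base[of "a \<odot> B" "a *s b"] B that by blast
    then have "B \<subseteq> inverse a \<odot> ospan (a \<odot> B)"
      using assms(2) by (force intro: image_eqI[of _ _ "a *s _"])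
    then have "L \<subseteq> inverse a \<odot> ospan (a \<odot> B)"
      unfolding B(4) by (intro ospan_least submod_dilate submod_ospan)
    then show "a \<odot> L \<subseteq> ospan (a \<odot> B)"
      using dilate_subset_iff[OF assms(2), of L "inverse a \<odot> ospan (a \<odot> B)"]
        dilate_inverse(2)[OF assms(2)] by simp
    show "ospan (a \<odot> B) \<subseteq> a \<odot> L"
      unfolding B(4) using ospan_base[OF B(1)] by (intro ospan_least submod_dilate submod_ospan) auto
  qed
  ultimately show ?thesis
    unfolding lattice_iff using B card_image[OF inj] by (intro exI[of _ "a \<odot> B"]) auto
qed

lemma lattice_dilate_iff: "a \<noteq> 0 \<Longrightarrow> lattice (a \<odot> L) \<longleftrightarrow> lattice L"
  using lattice_dilate[of L a] lattice_dilate[of "a \<odot> L" "inverse a"] by auto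

lemma coordinates_unique:
  assumes "finite B" "independent B" "(\<Sum>b\<in>B. c b *s b) = (\<Sum>b\<in>B. d b *s b)" "b \<in> B"
  shows "c b = d b"
proof (rule ccontr)
  assume "c b \<noteq> d b"
  moreover have "(\<Sum>b\<in>B. (c b - d b) *s b) = 0"
    using assms(3) by (simp add: scale_left_diff_distrib sum_subtractf)
  ultimately have "dependent B"
    unfolding dependent_finite[OF assms(1)] using assms(4) by (intro exI[of _ "\<lambda>b. c b - d b"]) auto
  then show False using assms(2) by simp
qed

lemma in_dilate_ospan_iff:
  assumes "finite B" "independent B"
  shows "(\<Sum>b\<in>B. c b *s b) \<in> \<pi> \<odot> ospan B \<longleftrightarrow> (\<forall>b\<in>B. c b \<in> \<mm>)"
proof
  assume "(\<Sum>b\<in>B. c b *s b) \<in> \<pi> \<odot> ospan B"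
  then obtain e where e: "\<forall>b\<in>B. e b \<in> \<O>" "(\<Sum>b\<in>B. c b *s b) = \<pi> *s (\<Sum>b\<in>B. e b *s b)"
    unfolding ospan_def by blast
  then have "(\<Sum>b\<in>B. c b *s b) = (\<Sum>b\<in>B. (\<pi> * e b) *s b)"
    by (simp add: scale_sum_right)
  then have "c b = \<pi> * e b" if b: "b \<in> B" for b
    by (rule coordinates_unique[OF assms, of c "\<lambda>b. \<pi> * e b", OF _ b])
  then show "\<forall>b\<in>B. c b \<in> \<mm>"
    using e(1) by (auto simp: maximal_ideal_eq)
next
  assume "\<forall>b\<in>B. c b \<in> \<mm>"
  then have "\<forall>b\<in>B. \<exists>e. e \<in> \<O> \<and> c b = \<pi> * e"
    unfolding maximal_ideal_eq by blast
  from bchoice[OF this] obtain e where e: "\<forall>b\<in>B. e b \<in> \<O> \<and> c b = \<pi> * e b" ..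
  then have "(\<Sum>b\<in>B. c b *s b) = \<pi> *s (\<Sum>b\<in>B. e b *s b)"
    by (simp add: scale_sum_right)
  moreover have "(\<Sum>b\<in>B. e b *s b) \<in> ospan B"
    unfolding ospan_def using e by blast
  ultimately show "(\<Sum>b\<in>B. c b *s b) \<in> \<pi> \<odot> ospan B" by blast
qed

text \<open>Coordinates with respect to a basis, taken modulo the maximal ideal, identify \<open>L/\<pi>L\<close> with the
  functions from the basis to the residue field.\<close>

lemma card_cosets_dilate_lattice:
  assumes "lattice L"
  shows "card (cosets (\<pi> \<odot> L) L) = q ^ dim UNIV"
proof -
  obtain B where B: "finite B" "independent B" "card B = dim UNIV" "L = ospan B"
    using assms by (auto simp: lattice_iff)
  let ?C = "PiE B (\<lambda>_. \<O>)"
  let ?v = "\<lambda>c. \<Sum>b\<in>B. c b *s b"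
  have sub: "submod (\<pi> \<odot> L)"
    using submod_dilate submod_lattice assms by blast
  have "L = ?v ` ?C"
  proof (intro set_eqI iffI)
    fix x assume "x \<in> L"
    then obtain c where "\<forall>b\<in>B. c b \<in> \<O>" "x = ?v c"
      unfolding B(4) ospan_def by blast
    then show "x \<in> ?v ` ?C"
      by (intro image_eqI[of _ _ "restrict c B"]) auto
  next
    fix x assume "x \<in> ?v ` ?C"
    then show "x \<in> L"
      unfolding B(4) ospan_def by blast
  qed
  then have "cosets (\<pi> \<odot> L) L = (\<lambda>c. (+) (?v c) ` (\<pi> \<odot> L)) ` ?C"
    unfolding cosets_def by (metis (mono_tags, lifting) image_cong image_image)
  moreover have "card ((\<lambda>c. (+) (?v c) ` (\<pi> \<odot> L)) ` ?C) =
      card ((\<lambda>c. \<lambda>b\<in>B. residue_class (c b)) ` ?C)"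
  proof (rule card_image_same_kernel)
    fix c d assume cd: "c \<in> ?C" "d \<in> ?C"
    have "(+) (?v c) ` (\<pi> \<odot> L) = (+) (?v d) ` (\<pi> \<odot> L) \<longleftrightarrow> ?v (\<lambda>b. c b - d b) \<in> \<pi> \<odot> L"
      by (simp add: coset_eq_iff[OF sub] scale_left_diff_distrib sum_subtractf)
    also have "\<dots> \<longleftrightarrow> (\<forall>b\<in>B. c b - d b \<in> \<mm>)"
      unfolding B(4) by (rule in_dilate_ospan_iff[OF B(1,2)])
    also have "\<dots> \<longleftrightarrow> (\<forall>b\<in>B. residue_class (c b) = residue_class (d b))"
      by (intro ball_cong refl) (simp add: residue_class_eq_iff PiE_mem[OF cd(1)] PiE_mem[OF cd(2)])
    also have "\<dots> \<longleftrightarrow> (\<lambda>b\<in>B. residue_class (c b)) = (\<lambda>b\<in>B. residue_class (d b))"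
      by (auto simp: fun_eq_iff restrict_def)
    finally show "(+) (?v c) ` (\<pi> \<odot> L) = (+) (?v d) ` (\<pi> \<odot> L) \<longleftrightarrow>
        (\<lambda>b\<in>B. residue_class (c b)) = (\<lambda>b\<in>B. residue_class (d b))" .
  qed
  moreover have "(\<lambda>c. \<lambda>b\<in>B. residue_class (c b)) ` ?C = PiE B (\<lambda>_. residue_field ord)"
  proof (intro set_eqI iffI)
    fix f assume f: "f \<in> PiE B (\<lambda>_. residue_field ord)"
    then have "\<forall>b\<in>B. \<exists>x. x \<in> \<O> \<and> f b = residue_class x"
      unfolding residue_field_eq by blast
    from bchoice[OF this] obtain c where c: "\<forall>b\<in>B. c b \<in> \<O> \<and> f b = residue_class (c b)" ..
    have "f b = (\<lambda>b\<in>B. residue_class (restrict c B b)) b" for b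
      using c PiE_arb[OF f, of b] by (cases "b \<in> B") simp_all
    then show "f \<in> (\<lambda>c. \<lambda>b\<in>B. residue_class (c b)) ` ?C"
      using c by (intro image_eqI[of _ _ "restrict c B"]) auto
  qed (auto simp: residue_field_eq)
  ultimately show ?thesis
    using card_PiE[OF B(1), of "\<lambda>_. residue_field ord"] card_residue_field B(3) by simp
qed

text \<open>Take a basis \<open>B\<close> of \<open>L\<close> with as many elements in \<open>M\<close> as possible.  If an element of \<open>M\<close> supported on
  \<open>B - M\<close> had a unit coordinate at \<open>b\<^sub>0\<close>, it could replace \<open>b\<^sub>0\<close> in the basis, against maximality.
  So all these coordinates are divisible by \<open>\<pi>\<close>, and \<open>M\<close> has as basis the elements of \<open>B \<inter> M\<close>
  together with \<open>\<pi>b\<close> for \<open>b \<in> B - M\<close>.\<close>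

lemma lattice_between:
  assumes L: "lattice L" and M: "submod M" and le: "\<pi> \<odot> L \<subseteq> M" "M \<subseteq> L"
  shows "lattice M"
proof -
  define basis where
    "basis B \<longleftrightarrow> finite B \<and> independent B \<and> card B = dim UNIV \<and> L = ospan B" for B
  obtain B0 where B0: "basis B0"
    using L unfolding lattice_iff basis_def by blast
  have "\<forall>B. basis B \<longrightarrow> card (B \<inter> M) < Suc (dim UNIV)"
    unfolding basis_def by (metis card_mono inf_le1 less_Suc_eq_le)
  then have "\<exists>B. basis B \<and> (\<forall>B'. basis B' \<longrightarrow> card (B' \<inter> M) \<le> card (B \<inter> M))"
    by (rule ex_has_greatest_nat[of basis, OF B0])
  then obtain B where "basis B" and
    B_max: "\<And>B'. basis B' \<Longrightarrow> card (B' \<inter> M) \<le> card (B \<inter> M)"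
    by blast
  then have B: "finite B" "independent B" "card B = dim UNIV" "L = ospan B"
    by (simp_all add: basis_def)
  have exchange: "c b0 \<in> \<mm>"
    if c: "\<And>b. b \<in> B - M \<Longrightarrow> c b \<in> \<O>" and x: "(\<Sum>b\<in>B - M. c b *s b) \<in> M" and b0: "b0 \<in> B - M"
    for c b0
  proof (rule ccontr)
    assume "c b0 \<notin> \<mm>"
    then have u: "c b0 \<noteq> 0" "inverse (c b0) \<in> \<O>"
      using unit_inverse c b0 by blast+
    define x where "x = (\<Sum>b\<in>B - M. c b *s b)"
    define r where "r = (\<Sum>b\<in>B - M - {b0}. c b *s b)"
    have x_eq: "x = c b0 *s b0 + r"
      unfolding x_def r_def using B(1) b0 by (intro sum.remove) auto
    have b0_eq: "b0 = inverse (c b0) *s (x - r)"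
      using u by (simp add: x_eq)
    have "r \<in> span (B - {b0})"
      unfolding r_def by (intro span_sum span_scale span_base) auto
    then have "x \<notin> span (B - {b0})"
      using b0_eq span_scale[OF span_diff, of x "B - {b0}" r "inverse (c b0)"] B(2) b0
      by (auto simp: dependent_def)
    then have x_new: "x \<notin> B - {b0}"
      using span_base[of x "B - {b0}"] by blast
    have x_notin: "x \<notin> B"
    proof
      assume "x \<in> B"
      then have "x = b0" using x_new by blast
      then show False using x b0 by (simp add: x_def)
    qed
    let ?B' = "insert x (B - {b0})"
    have "r \<in> ospan ?B'"
      unfolding r_def using c B(1)
      by (intro submod_sum[OF submod_ospan] submod_scale[OF submod_ospan] ospan_base) auto
    then have "b0 \<in> ospan ?B'"
      using b0_eq u B(1) submod_scale[OF submod_ospan, of "inverse (c b0)" "x - r" ?B']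
        submod_diff[OF submod_ospan, of x ?B' r] ospan_base[of ?B' x] by simp
    then have "B \<subseteq> ospan ?B'"
      using ospan_base[of ?B'] B(1) by blast
    moreover have "?B' \<subseteq> L"
      using ospan_base[OF B(1)] B(4) x le by (auto simp: x_def)
    ultimately have "L = ospan ?B'"
      using ospan_least[OF submod_ospan, of B ?B'] ospan_least[OF submod_lattice[OF L], of ?B'] B(4)
      by blast
    moreover have "independent ?B'"
      using B(2) \<open>x \<notin> span (B - {b0})\<close> independent_mono[of B "B - {b0}"]
      by (intro independent_insertI) auto
    moreover have "card ?B' = card B"
      using B(1) x_new b0 card_Suc_Diff1[of B b0] by simp
    ultimately have "basis ?B'"
      using B by (simp add: basis_def)
    moreover have "?B' \<inter> M = insert x (B \<inter> M)"
      using x b0 by (auto simp: x_def)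
    then have "card (?B' \<inter> M) = Suc (card (B \<inter> M))"
      using B(1) x_notin by simp
    ultimately show False
      using B_max[of ?B'] by simp
  qed
  define f where "f b = (if b \<in> M then b else \<pi> *s b)" for b
  have fM: "f b \<in> M" if "b \<in> B" for b
    using le(1) ospan_base[OF B(1) that] B(4) by (auto simp: f_def)
  have f_in: "f b \<in> ospan (f ` B)" if "b \<in> B" for b
    using ospan_base[of "f ` B" "f b"] B(1) that by blast
  have "M = ospan (f ` B)"
  proof
    show "ospan (f ` B) \<subseteq> M"
      using fM by (intro ospan_least M) blast
    show "M \<subseteq> ospan (f ` B)"
    proof
      fix x assume x: "x \<in> M"
      then obtain c where c: "\<forall>b\<in>B. c b \<in> \<O>" "x = (\<Sum>b\<in>B. c b *s b)"
        using le(2) B(4) unfolding ospan_def by blast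
      have split: "x = (\<Sum>b\<in>B - M. c b *s b) + (\<Sum>b\<in>B \<inter> M. c b *s b)"
        unfolding c(2) using sum.Int_Diff[OF B(1), of "\<lambda>b. c b *s b" M] by (simp add: add.commute)
      have "(\<Sum>b\<in>B \<inter> M. c b *s b) \<in> M"
        using c(1) by (intro submod_sum[OF M] submod_scale[OF M]) auto
      then have "(\<Sum>b\<in>B - M. c b *s b) \<in> M"
        using split submod_diff[OF M x] by (metis add_diff_cancel_right')
      then have cm: "c b \<in> \<mm>" if "b \<in> B - M" for b
        using exchange[of c b] c(1) that by blast
      have "c b *s b \<in> ospan (f ` B)" if b: "b \<in> B" for b
      proof (cases "b \<in> M")
        case True
        then show ?thesis
          using submod_scale[OF submod_ospan _ f_in[OF b], of "c b"] c(1) b by (simp add: f_def)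
      next
        case False
        then obtain d where "d \<in> \<O>" "c b = \<pi> * d"
          using cm[of b] b unfolding maximal_ideal_eq by blast
        then show ?thesis
          using submod_scale[OF submod_ospan _ f_in[OF b], of d] False
          by (simp add: f_def mult.commute)
      qed
      then show "x \<in> ospan (f ` B)"
        unfolding c(2) by (intro submod_sum[OF submod_ospan])
    qed
  qed
  moreover have "B \<subseteq> span (f ` B)"
  proof
    fix b assume "b \<in> B"
    then have "f b \<in> span (f ` B)"
      by (intro span_base) blast
    then show "b \<in> span (f ` B)"
      using span_scale[of "f b" "f ` B" "inverse \<pi>"] uniformizer_nonzero
      by (cases "b \<in> M") (simp_all add: f_def)
  qed
  moreover have "card (f ` B) = dim UNIV"
  proof (rule antisym)
    show "card (f ` B) \<le> dim UNIV"
      using card_image_le[OF B(1)] B(3) by simp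
    have "UNIV \<subseteq> span (f ` B)"
      using span_minimal[OF \<open>B \<subseteq> span (f ` B)\<close> subspace_span] span_basis[OF B(1-3)] by simp
    then show "dim UNIV \<le> card (f ` B)"
      using B(1) by (intro dim_le_card) auto
  qed
  ultimately show ?thesis
    unfolding lattice_iff using B span_basis[OF B(1-3)] basis_if_spanning[of B "f ` B"]
    by (intro exI[of _ "f ` B"]) auto
qed

end

section \<open>Simplices as chains of lattices\<close>

locale affine_building = local_field_space +
  assumes dim_ge_2: "2 \<le> dim UNIV"
begin

abbreviation hclass :: "'b set \<Rightarrow> 'b set set" where "hclass \<equiv> homothety_class scale"
abbreviation is_simplex :: "'b set set set \<Rightarrow> bool" where "is_simplex \<equiv> simplex ord \<pi> scale"
abbreviation is_chamber :: "'b set set set \<Rightarrow> bool" where "is_chamber \<equiv> chamber ord \<pi> scale"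

lemma in_hclass_iff: "M \<in> hclass L \<longleftrightarrow> (\<exists>a. a \<noteq> 0 \<and> M = a \<odot> L)"
  by (auto simp: homothety_class_def)

lemma hclass_self: "L \<in> hclass L"
  unfolding in_hclass_iff by (rule exI[of _ 1]) simp

lemma hclass_dilate:
  assumes "a \<noteq> 0"
  shows "hclass (a \<odot> L) = hclass L"
proof (intro set_eqI iffI)
  fix M assume "M \<in> hclass (a \<odot> L)"
  then obtain b where "b \<noteq> 0" "M = b \<odot> a \<odot> L"
    unfolding in_hclass_iff by blast
  then show "M \<in> hclass L"
    unfolding in_hclass_iff using assms by (intro exI[of _ "b * a"]) (simp add: dilate_dilate)
next
  fix M assume "M \<in> hclass L"
  then obtain b where "b \<noteq> 0" "M = b \<odot> L"
    unfolding in_hclass_iff by blast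
  then show "M \<in> hclass (a \<odot> L)"
    unfolding in_hclass_iff using assms
    by (intro exI[of _ "b * inverse a"]) (simp add: dilate_dilate mult.assoc)
qed

lemma hclass_eqD:
  assumes "hclass L = hclass M"
  shows "\<exists>a. a \<noteq> 0 \<and> M = a \<odot> L"
  unfolding in_hclass_iff[symmetric] using hclass_self[of M] by (simp only: assms)

lemma dilate_psubset_lattice:
  assumes "lattice L"
  shows "\<pi> \<odot> L \<subset> L"
proof -
  note L = submod_lattice[OF assms]
  have "\<pi> \<odot> L \<noteq> L"
  proof
    assume eq: "\<pi> \<odot> L = L"
    have "cosets L L = {L}"
    proof -
      have "(+) x ` L = L" if "x \<in> L" for x
        using coset_eq_iff[OF L, of x 0] that by simp
      then show ?thesis
        unfolding cosets_def using submod_0[OF L] by (auto simp: image_iff)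
    qed
    then have "q ^ dim UNIV = 1"
      using card_cosets_dilate_lattice[OF assms] eq by simp
    then show False
      using one_less_power[of q "dim UNIV"] q_ge_2 dim_ge_2 by simp
  qed
  then show ?thesis
    using dilate_le_self[OF L uniformizer_nonzero] by (auto simp: ord_uniformizer)
qed

text \<open>The set is half-open because \<open>L\<close> and \<open>\<pi>L\<close> represent the same vertex: with \<open>\<pi>L\<close> left out, no
  homothety class meets it twice.\<close>

definition window :: "'b set \<Rightarrow> 'b set set" where
  "window L = {M. lattice M \<and> \<pi> \<odot> L \<subset> M \<and> M \<subseteq> L}"

lemma windowD:
  assumes "M \<in> window L"
  shows "lattice M" "submod M" "\<pi> \<odot> L \<subseteq> M" "\<not> M \<subseteq> \<pi> \<odot> L" "M \<subseteq> L"
  using assms submod_lattice[of M] unfolding window_def by (simp_all add: less_le_not_le)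

lemma windowI: "lattice M \<Longrightarrow> \<pi> \<odot> L \<subseteq> M \<Longrightarrow> M \<noteq> \<pi> \<odot> L \<Longrightarrow> M \<subseteq> L \<Longrightarrow> M \<in> window L"
  by (simp add: window_def less_le)

lemma in_window_self: "lattice L \<Longrightarrow> L \<in> window L"
  using dilate_psubset_lattice by (auto simp: window_def)

lemma window_iff_submod:
  "lattice L \<Longrightarrow> M \<in> window L \<longleftrightarrow> submod M \<and> \<pi> \<odot> L \<subset> M \<and> M \<subseteq> L"
  using lattice_between[of L M] submod_lattice[of M] by (auto simp: window_def)

lemma finite_cosets_dilate_lattice: "lattice L \<Longrightarrow> finite (cosets (\<pi> \<odot> L) L)"
  using card_cosets_dilate_lattice[of L] q_ge_2 by (intro card_ge_0_finite) simp

lemma finite_window: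
  assumes "lattice L"
  shows "finite (window L)"
proof (rule finite_subset)
  show "window L \<subseteq> {M. submod M \<and> \<pi> \<odot> L \<subseteq> M \<and> M \<subseteq> L}"
    by (auto dest: windowD)
  show "finite {M. submod M \<and> \<pi> \<odot> L \<subseteq> M \<and> M \<subseteq> L}"
    using assms
    by (intro finite_intermediate_submods submod_dilate submod_lattice finite_cosets_dilate_lattice)
qed

text \<open>If \<open>ord a = 0\<close> then \<open>N \<subseteq> M\<close>, and if \<open>ord a = 1\<close> then \<open>M \<subseteq> N\<close>.  For a larger valuation \<open>M\<close>, and for
  a negative one \<open>N\<close>, would lie in \<open>\<pi>L\<close>.\<close>

lemma dilate_in_window_comparable:
  assumes L: "submod L" and M: "M \<in> window L" and N: "N \<in> window L" and a: "a \<noteq> 0"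
    and le: "\<pi> \<odot> M \<subseteq> a \<odot> N" "a \<odot> N \<subseteq> M"
  shows "M \<subseteq> N \<or> N \<subseteq> M"
proof -
  note sub = windowD(2)[OF M] windowD(2)[OF N]
  consider "ord a \<le> -1" | "ord a = 0" | "ord a = 1" | "2 \<le> ord a" by linarith
  then show ?thesis
  proof cases
    case 1
    then have "inverse a \<odot> M \<subseteq> \<pi> \<odot> M"
      using a by (intro dilate_le_uniformizer sub) (auto simp: ord_inverse)
    also have "\<pi> \<odot> M \<subseteq> \<pi> \<odot> L"
      by (rule image_mono[OF windowD(5)[OF M]])
    finally have "inverse a \<odot> M \<subseteq> \<pi> \<odot> L" .
    moreover have "N \<subseteq> inverse a \<odot> M"
      using image_mono[OF le(2), of "scale (inverse a)"] dilate_inverse(1)[OF a, of N] by simp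
    ultimately show ?thesis
      using windowD(4)[OF N] by (meson order_trans)
  next
    case 2
    then show ?thesis
      using le(2) dilate_unit[OF sub(2) a] by metis
  next
    case 3
    then have "a \<odot> N \<subseteq> \<pi> \<odot> N"
      using a by (intro dilate_le_uniformizer sub) simp_all
    with le(1) have "\<pi> \<odot> M \<subseteq> \<pi> \<odot> N"
      by (rule order_trans)
    then show ?thesis
      using dilate_subset_iff[OF uniformizer_nonzero, of M N] by simp
  next
    case 4
    have ge: "1 \<le> ord (a / \<pi>)"
      using 4 a uniformizer_nonzero by (simp add: ord_divide ord_uniformizer)
    have "\<pi> \<odot> (a / \<pi>) \<odot> N = a \<odot> N"
      unfolding dilate_dilate using uniformizer_nonzero by simp
    then have "M \<subseteq> (a / \<pi>) \<odot> N"
      using le(1) dilate_subset_iff[OF uniformizer_nonzero, of M "(a / \<pi>) \<odot> N"] by simp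
    also have "(a / \<pi>) \<odot> N \<subseteq> \<pi> \<odot> N"
      by (rule dilate_le_uniformizer[OF sub(2) _ ge]) (use a uniformizer_nonzero in simp)
    also have "\<pi> \<odot> N \<subseteq> \<pi> \<odot> L"
      by (rule image_mono[OF windowD(5)[OF N]])
    finally show ?thesis
      using windowD(4)[OF M] by simp
  qed
qed

text \<open>A factor of positive valuation would put \<open>a \<odot> M\<close> into \<open>\<pi>L\<close>; if the valuation were negative, the
  inverse factor would put \<open>M\<close> there.  So \<open>a\<close> is a unit.\<close>

lemma window_dilate_eq:
  assumes L: "submod L" and M: "M \<in> window L" "a \<odot> M \<in> window L" and a: "a \<noteq> 0"
  shows "a \<odot> M = M"
proof -
  have aux: "ord b \<le> 0" if b: "b \<noteq> 0" and N: "N \<in> window L" "b \<odot> N \<in> window L" for b N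
  proof (rule ccontr)
    assume "\<not> ord b \<le> 0"
    then have "b \<odot> N \<subseteq> \<pi> \<odot> N"
      using b by (intro dilate_le_uniformizer windowD(2)[OF N(1)]) simp_all
    also have "\<pi> \<odot> N \<subseteq> \<pi> \<odot> L"
      by (rule image_mono[OF windowD(5)[OF N(1)]])
    finally show False
      using windowD(4)[OF N(2)] by simp
  qed
  have "ord (inverse a) \<le> 0"
    using aux[of "inverse a" "a \<odot> M"] M a dilate_inverse(1)[OF a, of M] by simp
  then have "ord a = 0"
    using aux[of a M] M a ord_inverse[OF a] by simp
  then show ?thesis
    by (rule dilate_unit[OF windowD(2)[OF M(1)] a])
qed

lemma inj_on_hclass_window:
  assumes "lattice L"
  shows "inj_on hclass (window L)"
proof (rule inj_onI)
  fix M N assume MN: "M \<in> window L" "N \<in> window L" "hclass M = hclass N"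
  obtain a where "a \<noteq> 0" "N = a \<odot> M"
    using hclass_eqD[OF MN(3)] by blast
  then show "M = N"
    using window_dilate_eq[OF submod_lattice[OF assms], of M a] MN by metis
qed

lemma incident_hclass_iff:
  "incident \<pi> scale (hclass M) (hclass N) \<longleftrightarrow> (\<exists>c. c \<noteq> 0 \<and> \<pi> \<odot> M \<subseteq> c \<odot> N \<and> c \<odot> N \<subseteq> M)"
proof
  assume "incident \<pi> scale (hclass M) (hclass N)"
  then obtain M' N' where M': "M' \<in> hclass M" and N': "N' \<in> hclass N"
    and le: "\<pi> \<odot> M' \<subseteq> N'" "N' \<subseteq> M'"
    unfolding incident_def by (elim bexE conjE)
  obtain a where a: "a \<noteq> 0" "M' = a \<odot> M"
    using M' unfolding in_hclass_iff by (elim exE conjE)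
  obtain b where b: "b \<noteq> 0" "N' = b \<odot> N"
    using N' unfolding in_hclass_iff by (elim exE conjE)
  have eq: "(inverse a * b) \<odot> N = inverse a \<odot> N'"
    by (simp only: dilate_dilate b(2))
  have "\<pi> \<odot> M = inverse a \<odot> \<pi> \<odot> M'"
    using a by (simp add: dilate_dilate mult.left_commute)
  then have "\<pi> \<odot> M \<subseteq> (inverse a * b) \<odot> N"
    unfolding eq using image_mono[OF le(1), of "scale (inverse a)"] by simp
  moreover have "M = inverse a \<odot> M'"
    using dilate_inverse(1)[OF a(1), of M] a(2) by simp
  then have "(inverse a * b) \<odot> N \<subseteq> M"
    unfolding eq using image_mono[OF le(2), of "scale (inverse a)"] by simp
  ultimately show "\<exists>c. c \<noteq> 0 \<and> \<pi> \<odot> M \<subseteq> c \<odot> N \<and> c \<odot> N \<subseteq> M"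
    using a b by (intro exI[of _ "inverse a * b"]) simp
next
  assume "\<exists>c. c \<noteq> 0 \<and> \<pi> \<odot> M \<subseteq> c \<odot> N \<and> c \<odot> N \<subseteq> M"
  then obtain c where "c \<noteq> 0" "\<pi> \<odot> M \<subseteq> c \<odot> N" "c \<odot> N \<subseteq> M" by (elim exE conjE)
  then show "incident \<pi> scale (hclass M) (hclass N)"
    unfolding incident_def using hclass_self[of M] hclass_self[of "c \<odot> N"]
    by (intro bexI[of _ M] bexI[of _ "c \<odot> N"]) (simp_all add: hclass_dilate)
qed

lemma incident_window_iff:
  assumes L: "lattice L" and M: "M \<in> window L" and N: "N \<in> window L"
  shows "incident \<pi> scale (hclass M) (hclass N) \<longleftrightarrow> M \<subseteq> N \<or> N \<subseteq> M"
proof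
  assume "incident \<pi> scale (hclass M) (hclass N)"
  then obtain c where "c \<noteq> 0" "\<pi> \<odot> M \<subseteq> c \<odot> N" "c \<odot> N \<subseteq> M"
    unfolding incident_hclass_iff by (elim exE conjE)
  then show "M \<subseteq> N \<or> N \<subseteq> M"
    by (rule dilate_in_window_comparable[OF submod_lattice[OF L] M N])
next
  have *: "\<pi> \<odot> M \<subseteq> N" "\<pi> \<odot> N \<subseteq> M"
    using image_mono[OF windowD(5)[OF M], of "scale \<pi>"] image_mono[OF windowD(5)[OF N], of "scale \<pi>"]
      windowD(3)[OF M] windowD(3)[OF N] by (meson order_trans)+
  assume "M \<subseteq> N \<or> N \<subseteq> M"
  then show "incident \<pi> scale (hclass M) (hclass N)"
    unfolding incident_hclass_iff
  proof
    assume le: "M \<subseteq> N"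
    have "\<pi> \<odot> M \<subseteq> \<pi> \<odot> N"
      by (rule image_mono[OF le])
    then show "\<exists>c. c \<noteq> 0 \<and> \<pi> \<odot> M \<subseteq> c \<odot> N \<and> c \<odot> N \<subseteq> M"
      using * uniformizer_nonzero by (intro exI[of _ \<pi>]) simp
  next
    assume "N \<subseteq> M"
    then show "\<exists>c. c \<noteq> 0 \<and> \<pi> \<odot> M \<subseteq> c \<odot> N \<and> c \<odot> N \<subseteq> M"
      using * by (intro exI[of _ 1]) simp
  qed
qed

text \<open>Rescaling the witness of incidence puts it between \<open>\<pi>L\<close> and \<open>L\<close>; if it is \<open>\<pi>L\<close>, its class is
  represented in the window by \<open>L\<close>.\<close>

lemma incident_obtain_window:
  assumes L: "lattice L" and s: "s \<in> vertices ord scale" and inc: "incident \<pi> scale (hclass L) s"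
  obtains M where "M \<in> window L" "s = hclass M"
proof -
  obtain N where N: "lattice N" "s = hclass N"
    using s by (auto simp: vertices_def)
  obtain c where c: "c \<noteq> 0" "\<pi> \<odot> L \<subseteq> c \<odot> N" "c \<odot> N \<subseteq> L"
    using inc unfolding N(2) incident_hclass_iff by (elim exE conjE)
  define M where "M = c \<odot> N"
  have M: "lattice M" "s = hclass M"
    using c N by (simp_all add: M_def lattice_dilate hclass_dilate)
  show thesis
  proof (cases "M = \<pi> \<odot> L")
    case True
    then show ?thesis
      using that[OF in_window_self[OF L]] M uniformizer_nonzero by (simp add: hclass_dilate)
  next
    case False
    then show ?thesis
      using that[OF windowI[of M L]] M c by (simp add: M_def)
  qed
qed

lemma hclass_window_vertex: "M \<in> window L \<Longrightarrow> hclass M \<in> vertices ord scale"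
  by (auto simp: vertices_def window_def)

lemma simplex_if_chain:
  assumes L: "lattice L" and C: "C \<subseteq> window L" "chain\<^sub>\<subseteq> C"
  shows "is_simplex (hclass ` C)"
  unfolding simplex_def
proof (intro conjI ballI)
  show "finite (hclass ` C)"
    using finite_subset[OF C(1) finite_window[OF L]] by blast
  show "hclass ` C \<subseteq> vertices ord scale"
    using C(1) hclass_window_vertex by blast
  fix s s' assume "s \<in> hclass ` C" "s' \<in> hclass ` C"
  then obtain M N where "M \<in> C" "N \<in> C" "s = hclass M" "s' = hclass N" by blast
  then show "incident \<pi> scale s s'"
    using incident_window_iff[OF L, of M N] C unfolding chain_subset_def by blast
qed

lemma simplex_obtain_chain:
  assumes S: "is_simplex S" "hclass L \<in> S" and L: "lattice L"
  obtains C where "C \<subseteq> window L" "chain\<^sub>\<subseteq> C" "S = hclass ` C"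
proof
  let ?C = "{M \<in> window L. hclass M \<in> S}"
  show "?C \<subseteq> window L" by blast
  show "chain\<^sub>\<subseteq> ?C"
    using S(1) incident_window_iff[OF L] unfolding chain_subset_def simplex_def by blast
  show "S = hclass ` ?C"
  proof
    show "S \<subseteq> hclass ` ?C"
    proof
      fix s assume s: "s \<in> S"
      then obtain M where "M \<in> window L" "s = hclass M"
        using incident_obtain_window[OF L, of s] S unfolding simplex_def by blast
      then show "s \<in> hclass ` ?C"
        using s by blast
    qed
  qed blast
qed

definition maximal_chain :: "'b set \<Rightarrow> 'b set set \<Rightarrow> bool" where
  "maximal_chain L C \<longleftrightarrow> C \<subseteq> window L \<and> chain\<^sub>\<subseteq> C \<and>
     (\<forall>M\<in>window L. (\<forall>N\<in>C. M \<subseteq> N \<or> N \<subseteq> M) \<longrightarrow> M \<in> C)"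

lemma maximal_chainD:
  assumes "maximal_chain L C"
  shows "C \<subseteq> window L" "chain\<^sub>\<subseteq> C"
    "\<And>M. M \<in> window L \<Longrightarrow> (\<And>N. N \<in> C \<Longrightarrow> M \<subseteq> N \<or> N \<subseteq> M) \<Longrightarrow> M \<in> C"
  using assms by (auto simp: maximal_chain_def)

lemma self_in_maximal_chain:
  assumes "lattice L" "maximal_chain L C"
  shows "L \<in> C"
  using maximal_chainD(3)[OF assms(2) in_window_self[OF assms(1)]] maximal_chainD(1)[OF assms(2)]
  unfolding window_def by blast

text \<open>A simplex containing this one contains \<open>[L]\<close>, so it comes from a chain in the same window; the
  injectivity of \<open>hclass\<close> there turns inclusion of simplices into inclusion of chains.\<close>

lemma chamber_if_maximal_chain:
  assumes L: "lattice L" and C: "maximal_chain L C"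
  shows "is_chamber (hclass ` C)"
  unfolding chamber_def
proof (intro conjI allI impI)
  note C' = maximal_chainD[OF C]
  show "is_simplex (hclass ` C)"
    using simplex_if_chain[OF L C'(1,2)] .
  fix S assume S: "is_simplex S \<and> hclass ` C \<subseteq> S"
  then have "hclass L \<in> S"
    using self_in_maximal_chain[OF L C] by blast
  then obtain D where D: "D \<subseteq> window L" "chain\<^sub>\<subseteq> D" "S = hclass ` D"
    using simplex_obtain_chain[of S L] S L by blast
  have "C \<subseteq> D"
  proof
    fix M assume M: "M \<in> C"
    then have "hclass M \<in> hclass ` D"
      using S D(3) by blast
    then show "M \<in> D"
      using inj_on_image_mem_iff[OF inj_on_hclass_window[OF L] _ D(1), of M] M C'(1) by blast
  qed
  moreover have "M \<in> C" if "M \<in> D" for M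
    using C'(3)[of M] D(1,2) that \<open>C \<subseteq> D\<close> unfolding chain_subset_def by blast
  ultimately show "S = hclass ` C"
    using D(3) by blast
qed

lemma chamber_obtain_maximal_chain:
  assumes C: "is_chamber S" "hclass L \<in> S" and L: "lattice L"
  obtains C where "maximal_chain L C" "S = hclass ` C"
proof -
  have S: "is_simplex S" and S_max: "\<And>S'. is_simplex S' \<Longrightarrow> S \<subseteq> S' \<Longrightarrow> S' = S"
    using C by (auto simp: chamber_def)
  obtain C where C: "C \<subseteq> window L" "chain\<^sub>\<subseteq> C" "S = hclass ` C"
    using simplex_obtain_chain[OF S C(2) L] .
  have "M \<in> C" if M: "M \<in> window L" "\<forall>N\<in>C. M \<subseteq> N \<or> N \<subseteq> M" for M
  proof -
    have "chain\<^sub>\<subseteq> (insert M C)"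
      using C(2) M(2) unfolding chain_subset_def by blast
    then have "hclass ` insert M C = hclass ` C"
      using S_max[of "hclass ` insert M C"] simplex_if_chain[OF L, of "insert M C"] C M by blast
    then have "insert M C = C"
      using inj_on_image_eq_iff[OF inj_on_hclass_window[OF L], of "insert M C" C] C M by blast
    then show ?thesis by blast
  qed
  then have "maximal_chain L C"
    using C unfolding maximal_chain_def by blast
  then show thesis
    using that C by blast
qed

lemma extend_to_maximal_chain:
  assumes L: "lattice L" and K: "K \<subseteq> window L" "chain\<^sub>\<subseteq> K"
  obtains C where "maximal_chain L C" "K \<subseteq> C"
proof -
  let ?X = "{C. K \<subseteq> C \<and> C \<subseteq> window L \<and> chain\<^sub>\<subseteq> C}"
  have "finite ?X"
    by (rule finite_subset[of _ "Pow (window L)"]) (use finite_window[OF L] in auto)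
  then obtain C where C: "C \<in> ?X" "\<forall>D\<in>?X. C \<subseteq> D \<longrightarrow> C = D"
    using finite_has_maximal[of ?X] K by blast
  have "M \<in> C" if M: "M \<in> window L" "\<forall>N\<in>C. M \<subseteq> N \<or> N \<subseteq> M" for M
  proof -
    have "chain\<^sub>\<subseteq> (insert M C)"
      using C(1) M(2) unfolding chain_subset_def by blast
    then have "insert M C \<in> ?X"
      using C(1) M(1) by blast
    then have "C = insert M C"
      using C(2) by (meson subset_insertI)
    then show ?thesis by blast
  qed
  then have "maximal_chain L C"
    using C(1) unfolding maximal_chain_def by simp
  then show thesis
    using that[of C] C(1) by simp
qed

end

section \<open>Close vertices and exchangeable lattices\<close>

context affine_building
begin

text \<open>The multiples of the members of a chain in a window form a chain that is periodic under \<open>\<pi>\<close>.  Here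
  \<open>A\<close> and \<open>D\<close> are the neighbours that \<open>L\<close> and \<open>M\<close> have in such a chain, and \<open>\<pi>D \<subseteq> A\<close> ensures that
  one period can be chosen from \<open>\<pi>D\<close> to \<open>D\<close>.\<close>

definition exchangeable :: "'b set \<Rightarrow> 'b set \<Rightarrow> bool" where
  "exchangeable L M \<longleftrightarrow> M \<noteq> L \<and>
     (\<exists>A D. \<pi> \<odot> D \<subseteq> A \<and> A \<lhd> L \<and> L \<lhd> D \<and> A \<lhd> M \<and> M \<lhd> D)"

lemma exchangeable_dilate:
  assumes "exchangeable L M" "a \<noteq> 0"
  shows "exchangeable (a \<odot> L) (a \<odot> M)"
proof -
  obtain A D where AD: "M \<noteq> L" "\<pi> \<odot> D \<subseteq> A" "A \<lhd> L" "L \<lhd> D" "A \<lhd> M" "M \<lhd> D"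
    using assms(1) unfolding exchangeable_def by (elim exE conjE)
  have "\<pi> \<odot> a \<odot> D \<subseteq> a \<odot> A"
    using image_mono[OF AD(2), of "scale a"] by (simp add: dilate_dilate mult.commute)
  moreover have "a \<odot> M \<noteq> a \<odot> L"
    using AD(1) assms(2) by simp
  ultimately show ?thesis
    unfolding exchangeable_def using AD(3-6) assms(2)
    by (intro exI[of _ "a \<odot> A"] exI[of _ "a \<odot> D"] conjI dilate_covered_by)
qed

lemma lattice_above:
  assumes "lattice L" "submod M" "L \<subseteq> M" "\<pi> \<odot> M \<subseteq> L"
  shows "lattice M"
proof -
  have "\<pi> \<odot> M \<subseteq> L" "\<pi> \<odot> L \<subseteq> \<pi> \<odot> M"
    using assms image_mono by blast+
  then have "lattice (\<pi> \<odot> M)"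
    using lattice_between[OF assms(1) submod_dilate[OF assms(2)]] by simp
  then show ?thesis
    using lattice_dilate_iff[OF uniformizer_nonzero] by simp
qed

text \<open>A submodule strictly inside one of the gaps is a lattice in the window and comparable with the
  whole chain, so it would have to be a member.  The lower end \<open>A\<close> may be \<open>\<pi>L\<close>, which is not a member
  of the chain.\<close>

lemma covers_in_maximal_chain:
  assumes L: "lattice L" and C: "maximal_chain L C"
    and A: "submod A" "\<pi> \<odot> L \<subseteq> A" and M: "M \<in> C" and D: "D \<in> C"
    and AM: "A \<subset> M" and MD: "M \<subset> D"
    and gap: "\<And>G. G \<in> C \<Longrightarrow> G \<subseteq> A \<or> G = M \<or> D \<subseteq> G"
  shows "A \<lhd> M" "M \<lhd> D"
proof -
  note C' = maximal_chainD[OF C]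
  note wM = windowD[OF subsetD[OF C'(1) M]] and wD = windowD[OF subsetD[OF C'(1) D]]
  have key: "N = M"
    if N: "submod N" "A \<subseteq> N" "N \<subseteq> D" and comparable: "N \<subseteq> M \<or> M \<subseteq> N" and ne: "N \<noteq> A" "N \<noteq> D"
    for N
  proof -
    have le: "\<pi> \<odot> L \<subseteq> N" "N \<subseteq> L"
      using A(2) N(2,3) wD(5) by (meson order_trans)+
    moreover have "N \<noteq> \<pi> \<odot> L"
      using A(2) N(2) ne(1) by (metis subset_antisym)
    ultimately have "N \<in> window L"
      using lattice_between[OF L N(1)] by (intro windowI) simp_all
    moreover have "N \<subseteq> G \<or> G \<subseteq> N" if "G \<in> C" for G
      using gap[OF that] N(2,3) comparable by (metis order_trans)
    ultimately have "N \<in> C"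
      by (rule C'(3))
    then show ?thesis
      using gap[of N] N(2,3) ne by (metis subset_antisym)
  qed
  show "A \<lhd> M"
    unfolding covered_by_def
  proof (intro conjI allI impI A(1) wM(2) AM)
    fix N assume "submod N \<and> A \<subseteq> N \<and> N \<subseteq> M"
    then show "N = A \<or> N = M"
      using key[of N] MD by (metis psubsetE subset_trans)
  qed
  show "M \<lhd> D"
    unfolding covered_by_def
  proof (intro conjI allI impI wM(2) wD(2) MD)
    fix N assume "submod N \<and> M \<subseteq> N \<and> N \<subseteq> D"
    then show "N = M \<or> N = D"
      using key[of N] AM by (metis psubsetE subset_trans)
  qed
qed

text \<open>Let \<open>A\<close> and \<open>D\<close> be the neighbours of \<open>M\<close> in the chain.  If \<open>N\<close> did not lie in the gap between \<open>A\<close>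
  and \<open>D\<close>, it would be comparable with \<open>M\<close> and could be added to the first chain.\<close>

lemma exchangeable_if_maximal_chains:
  assumes L: "lattice L" and LG: "L \<in> G"
    and M: "maximal_chain L (insert M G)" "M \<notin> G" and N: "maximal_chain L (insert N G)" "N \<notin> G"
    and "M \<noteq> N"
  shows "exchangeable M N"
proof -
  note M' = maximal_chainD[OF M(1)] and N' = maximal_chainD[OF N(1)]
  have wM: "M \<in> window L" and wN: "N \<in> window L" and wG: "\<And>X. X \<in> G \<Longrightarrow> X \<in> window L"
    using M'(1) N'(1) by auto
  have comparable_M: "\<And>X. X \<in> G \<Longrightarrow> X \<subseteq> M \<or> M \<subseteq> X"
    and comparable_N: "\<And>X. X \<in> G \<Longrightarrow> X \<subseteq> N \<or> N \<subseteq> X"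
    and comparable_G: "\<And>X Y. X \<in> G \<Longrightarrow> Y \<in> G \<Longrightarrow> X \<subseteq> Y \<or> Y \<subseteq> X"
    using M'(2) N'(2) unfolding chain_subset_def by (metis insertCI)+
  have finG: "finite G"
    using finite_subset[OF M'(1) finite_window[OF L]] by simp
  let ?A = "{X \<in> insert (\<pi> \<odot> L) G. X \<subset> M}" and ?D = "{X \<in> G. M \<subset> X}"
  have "finite ?A" "finite ?D"
    using finG by simp_all
  have "\<pi> \<odot> L \<in> ?A"
    using windowD(3,4)[OF wM] by auto
  then obtain A where A: "A \<in> ?A" "\<And>X. X \<in> ?A \<Longrightarrow> A \<subseteq> X \<Longrightarrow> A = X"
    using finite_has_maximal[OF \<open>finite ?A\<close>] by (metis (no_types, lifting) empty_iff)
  have "L \<in> ?D"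
    using LG M(2) windowD(5)[OF wM] by auto
  then obtain D where D: "D \<in> ?D" "\<And>X. X \<in> ?D \<Longrightarrow> X \<subseteq> D \<Longrightarrow> D = X"
    using finite_has_minimal[OF \<open>finite ?D\<close>] by (metis (no_types, lifting) empty_iff)
  have A': "submod A" "\<pi> \<odot> L \<subseteq> A" "A \<subset> M" "A = \<pi> \<odot> L \<or> A \<in> G"
    using A(1) windowD(2,3)[OF wG] submod_dilate[OF submod_lattice[OF L]] by auto
  have D': "D \<in> G" "M \<subset> D"
    using D(1) by auto
  have gap: "X \<subseteq> A \<or> D \<subseteq> X" if X: "X \<in> G" for X
  proof (cases "X \<subseteq> M")
    case True
    then have X': "X \<in> ?A"
      using X M(2) by auto
    have "X \<subseteq> A \<or> A \<subseteq> X"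
      using A'(4) comparable_G[OF X] windowD(3)[OF wG[OF X]] by auto
    then show ?thesis
      using A(2)[OF X'] by auto
  next
    case False
    then have X': "X \<in> ?D"
      using X comparable_M[OF X] by auto
    then show ?thesis
      using D(2)[OF X'] comparable_G[OF X D'(1)] by auto
  qed
  have not_le: "\<not> N \<subseteq> A"
  proof
    assume "N \<subseteq> A"
    then have "N \<in> insert M G"
      using comparable_N A'(3) by (intro M'(3)[OF wN]) auto
    then show False using N(2) \<open>M \<noteq> N\<close> by simp
  qed
  have "A \<subseteq> N \<or> N \<subseteq> A"
    using A'(4) comparable_N windowD(3)[OF wN] by auto
  then have AN: "A \<subset> N"
    using not_le by auto
  have "\<not> D \<subseteq> N"
  proof
    assume "D \<subseteq> N"
    then have "N \<in> insert M G"
      using comparable_N D'(2) by (intro M'(3)[OF wN]) auto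
    then show False using N(2) \<open>M \<noteq> N\<close> by simp
  qed
  then have ND: "N \<subset> D"
    using comparable_N[OF D'(1)] by auto
  have "\<pi> \<odot> D \<subseteq> \<pi> \<odot> L"
    by (rule image_mono[OF windowD(5)[OF wG[OF D'(1)]]])
  then have "\<pi> \<odot> D \<subseteq> A"
    using A'(2) by (rule order_trans)
  moreover have "A \<lhd> M" "M \<lhd> D"
    using covers_in_maximal_chain[OF L M(1) A'(1,2) _ _ A'(3) D'(2)] D'(1) gap by blast+
  moreover have "A \<lhd> N" "N \<lhd> D"
    using covers_in_maximal_chain[OF L N(1) A'(1,2) _ _ AN ND] D'(1) gap by blast+
  ultimately show ?thesis
    unfolding exchangeable_def using \<open>M \<noteq> N\<close> by metis
qed

text \<open>The member \<open>L\<close> lies between the neighbours \<open>A\<close> and \<open>D\<close>, so every other member is \<open>D\<close> or is contained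
  in \<open>A\<close>.  Whatever can be added to the new chain is therefore contained in \<open>A\<close>, hence in \<open>L\<close>, and
  belongs to the old chain, or lies between \<open>A\<close> and \<open>D\<close> and is \<open>M\<close> or \<open>D\<close>.\<close>

lemma maximal_chain_exchange:
  assumes D: "lattice D" and C: "maximal_chain D C"
    and covers: "A \<lhd> L" "L \<lhd> D" "A \<lhd> M" "M \<lhd> D" and A: "\<pi> \<odot> D \<subseteq> A"
    and inC: "L \<in> C" "A \<in> C \<or> A = \<pi> \<odot> D"
  shows "maximal_chain D (insert M (C - {L}))"
proof -
  note C' = maximal_chainD[OF C]
  note AL = covered_byD[OF covers(1)] and LD = covered_byD[OF covers(2)]
    and AM = covered_byD[OF covers(3)] and MD = covered_byD[OF covers(4)]
  have "D \<in> C"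
    by (rule self_in_maximal_chain[OF D C])
  have wM: "M \<in> window D"
    using A AM MD by (auto simp: window_iff_submod[OF D])
  have A_comparable: "X \<subseteq> A \<or> A \<subseteq> X" if X: "X \<in> window D" "\<And>Y. Y \<in> C - {L} \<Longrightarrow> X \<subseteq> Y \<or> Y \<subseteq> X" for X
    using inC(2) X(2)[of A] windowD(3)[OF X(1)] AL(3) by auto
  have gap: "X \<subseteq> A \<or> X = D" if X: "X \<in> C - {L}" for X
  proof -
    have wX: "X \<in> window D" using X C'(1) by blast
    have "X \<subseteq> A \<or> A \<subseteq> X"
      using A_comparable[OF wX] C'(2) X unfolding chain_subset_def by auto
    moreover have "X \<subseteq> L \<or> L \<subseteq> X"
      using C'(2) X inC(1) unfolding chain_subset_def by auto
    ultimately show ?thesis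
      using AL(5)[of X] LD(5)[of X] windowD(2,5)[OF wX] X by auto
  qed
  have "X \<in> insert M (C - {L})"
    if X: "X \<in> window D" and comparable: "\<And>Y. Y \<in> insert M (C - {L}) \<Longrightarrow> X \<subseteq> Y \<or> Y \<subseteq> X" for X
  proof (cases "X \<subseteq> A")
    case True
    have "X \<in> C"
      using C'(3)[OF X] comparable True AL(4) by blast
    moreover have "X \<noteq> L"
      using True AL(3) by blast
    ultimately show ?thesis by blast
  next
    case False
    then have "A \<subseteq> X"
      using A_comparable[OF X] comparable by blast
    moreover have "X \<subseteq> M \<or> M \<subseteq> X"
      using comparable by blast
    ultimately have "X = M \<or> X = D"
      using AM(5)[of X] MD(5)[of X] windowD(2,5)[OF X] False by auto
    then show ?thesis
      using \<open>D \<in> C\<close> LD(3) by blast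
  qed
  moreover have "chain\<^sub>\<subseteq> (insert M (C - {L}))"
    using C'(2) gap AM(4) MD(4) unfolding chain_subset_def by (auto; blast)
  ultimately show ?thesis
    using C'(1) wM unfolding maximal_chain_def by blast
qed

text \<open>Guarantees that two adjacent chambers share a vertex.  A line in \<open>L/\<pi>L\<close> has \<open>q\<close> elements and so is
  not the whole space in dimension at least 2.\<close>

lemma chamber_not_singleton:
  assumes L: "lattice L"
  shows "\<not> is_chamber {hclass L}"
proof
  assume "is_chamber {hclass L}"
  then obtain C where C: "maximal_chain L C" "{hclass L} = hclass ` C"
    using chamber_obtain_maximal_chain[of "{hclass L}" L] L by blast
  note C' = maximal_chainD[OF C(1)]
  note subL = submod_lattice[OF L]
  have C_eq: "X = L" if X: "X \<in> C" for X
  proof -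
    have "hclass X = hclass L"
      using C(2) X by blast
    then show ?thesis
      using inj_onD[OF inj_on_hclass_window[OF L]] C'(1) X in_window_self[OF L] by blast
  qed
  obtain x where x: "x \<in> L" "x \<notin> \<pi> \<odot> L"
    using dilate_psubset_lattice[OF L] by blast
  let ?N = "adjoin (\<pi> \<odot> L) x"
  have sub: "submod (\<pi> \<odot> L)"
    by (rule submod_dilate[OF subL])
  have "\<pi> *s x \<in> \<pi> \<odot> L"
    using x by blast
  then have index: "card (cosets (\<pi> \<odot> L) ?N) = q"
    using card_cosets_adjoin[OF sub x(2)] by simp
  have NL: "?N \<subseteq> L"
    using adjoin_least[OF subL _ x(1)] dilate_psubset_lattice[OF L] by blast
  have "?N \<noteq> \<pi> \<odot> L"
    using in_adjoin[OF sub, of x] x(2) by auto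
  then have "?N \<in> window L"
    using NL subset_adjoin[of "\<pi> \<odot> L" x] submod_adjoin[OF sub, of x]
    by (auto simp: window_iff_submod[OF L])
  then have "?N \<in> C"
    using C'(3)[of ?N] C_eq NL by auto
  then have "?N = L"
    by (rule C_eq)
  then have "q = q ^ dim UNIV"
    using index card_cosets_dilate_lattice[OF L] by simp
  moreover have "q ^ 1 < q ^ dim UNIV"
    using q_ge_2 dim_ge_2 by (intro power_strict_increasing) simp_all
  ultimately show False by simp
qed

lemma close_imp_exchangeable:
  assumes L: "lattice L" and cl: "close ord \<pi> scale (hclass L) t'"
  obtains M where "exchangeable L M" "t' = hclass M"
proof -
  let ?t = "hclass L"
  obtain C C' F where C: "is_chamber C" "?t \<in> C" "?t \<notin> C'" and C': "is_chamber C'" "t' \<in> C'" "t' \<notin> C"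
    and F: "F \<subseteq> C" "card C = card F + 1" "F \<subseteq> C'" "card C' = card F + 1"
    using cl unfolding close_def adjacent_def codim_one_face_def by blast
  have fin: "finite C" "finite C'"
    using C(1) C'(1) by (auto simp: chamber_def simplex_def)
  have finF: "finite F"
    using F(1) fin(1) by (rule finite_subset)
  have nF: "?t \<notin> F" "t' \<notin> F"
    using F C C' by auto
  have C_eq: "insert ?t F = C"
    using fin(1) F(1,2) C(2) nF(1) finF by (intro card_subset_eq) auto
  have C'_eq: "insert t' F = C'"
    using fin(2) F(3,4) C'(2) nF(2) finF by (intro card_subset_eq) auto
  have "F \<noteq> {}"
    using chamber_not_singleton[OF L] C(1) C_eq by auto
  then obtain s where s: "s \<in> F" by blast
  then have "s \<in> vertices ord scale"
    using C(1) F(1) by (auto simp: chamber_def simplex_def)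
  then obtain B where B: "lattice B" "s = hclass B"
    by (auto simp: vertices_def)
  note inj = inj_on_hclass_window[OF B(1)]
  obtain X where X: "maximal_chain B X" "C = hclass ` X"
    using chamber_obtain_maximal_chain[OF C(1) _ B(1)] s B(2) F(1) by blast
  obtain Y where Y: "maximal_chain B Y" "C' = hclass ` Y"
    using chamber_obtain_maximal_chain[OF C'(1) _ B(1)] s B(2) F(3) by blast
  note wX = maximal_chainD(1)[OF X(1)] and wY = maximal_chainD(1)[OF Y(1)]
  obtain M where M: "M \<in> X" "?t = hclass M"
    using C(2) unfolding X(2) by (rule imageE)
  obtain N where N: "N \<in> Y" "t' = hclass N"
    using C'(2) unfolding Y(2) by (rule imageE)
  have "hclass ` (X - {M}) = C - {?t}"
    unfolding X(2) M(2) using inj_on_image_set_diff[OF inj, of X "{M}"] wX M(1) by auto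
  moreover have "C - {?t} = F"
    unfolding C_eq[symmetric] using nF(1) by simp
  moreover have "hclass ` (Y - {N}) = C' - {t'}"
    unfolding Y(2) N(2) using inj_on_image_set_diff[OF inj, of Y "{N}"] wY N(1) by auto
  moreover have "C' - {t'} = F"
    unfolding C'_eq[symmetric] using nF(2) by simp
  ultimately have "hclass ` (X - {M}) = hclass ` (Y - {N})"
    by (simp only:)
  moreover have "X - {M} \<subseteq> window B" "Y - {N} \<subseteq> window B"
    using wX wY by auto
  ultimately have XY: "X - {M} = Y - {N}"
    by (simp only: inj_on_image_eq_iff[OF inj])
  let ?G = "X - {M}"
  have "B \<noteq> M"
    using s B(2) M(2) nF(1) by auto
  then have "B \<in> ?G"
    using self_in_maximal_chain[OF B(1) X(1)] by simp
  moreover have "insert M ?G = X" "insert N ?G = Y"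
    using M(1) N(1) XY by auto
  moreover have "N \<notin> ?G"
    using XY by auto
  moreover have "M \<noteq> N"
    using M N C C' by auto
  ultimately have ex: "exchangeable M N"
    using exchangeable_if_maximal_chains[OF B(1), of ?G M N] X(1) Y(1) by simp
  obtain a where a: "a \<noteq> 0" "L = a \<odot> M"
    using hclass_eqD[of M L] M(2) by auto
  show thesis
    using that[of "a \<odot> N"] exchangeable_dilate[OF ex a(1)] a N(2) by (simp add: hclass_dilate)
qed

lemma exchangeable_lattices:
  assumes L: "lattice L" and AD: "\<pi> \<odot> D \<subseteq> A" "A \<lhd> L" "L \<lhd> D" "A \<lhd> M" "M \<lhd> D"
  shows "lattice D" "lattice M" "L \<in> window D" "M \<in> window D"
proof -
  note AL = covered_byD[OF AD(2)] and LD = covered_byD[OF AD(3)]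
    and AM = covered_byD[OF AD(4)] and MD = covered_byD[OF AD(5)]
  have "\<pi> \<odot> D \<subseteq> L"
    using AD(1) AL(4) by (rule order_trans)
  then show D: "lattice D"
    using lattice_above[OF L LD(2,4)] by simp
  show "L \<in> window D" "M \<in> window D"
    using AD(1) AL AM LD MD by (auto simp: window_iff_submod[OF D])
  then show "lattice M"
    using windowD(1) by blast
qed

lemma exchangeable_imp_close:
  assumes L: "lattice L" and ex: "exchangeable L M"
  shows "close ord \<pi> scale (hclass L) (hclass M)"
proof -
  obtain A D where ne: "M \<noteq> L" and AD: "\<pi> \<odot> D \<subseteq> A" "A \<lhd> L" "L \<lhd> D" "A \<lhd> M" "M \<lhd> D"
    using ex unfolding exchangeable_def by (elim exE conjE)
  note lat = exchangeable_lattices[OF L AD]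
  note D = lat(1)
  have A_window: "A \<noteq> \<pi> \<odot> D \<Longrightarrow> A \<in> window D"
    using AD(1) covered_byD[OF AD(2)] covered_byD[OF AD(3)]
    by (auto simp: window_iff_submod[OF D])
  \<comment> \<open>If \<open>A = \<pi>D\<close>, it is the excluded lower end of the window and not a member of the chain.\<close>
  let ?K = "insert L ({A} - {\<pi> \<odot> D})"
  have "?K \<subseteq> window D"
    using A_window lat(3) by auto
  moreover have "chain\<^sub>\<subseteq> ?K"
    using covered_byD(4)[OF AD(2)] by (auto simp: chain_subset_def)
  ultimately obtain C where C: "maximal_chain D C" "?K \<subseteq> C"
    using extend_to_maximal_chain[OF D] by blast
  let ?G = "C - {L}" and ?C' = "insert M (C - {L})"
  note C' = maximal_chainD[OF C(1)]
  have C'_max: "maximal_chain D ?C'"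
    by (rule maximal_chain_exchange[OF D C(1) AD(2-5,1)]) (use C(2) in auto)
  have "M \<notin> C"
  proof
    assume "M \<in> C"
    then have "M \<subseteq> L \<or> L \<subseteq> M"
      using C'(2) C(2) unfolding chain_subset_def by blast
    then show False
      using covered_byD(5)[OF AD(2), of M] covered_byD(5)[OF AD(3), of M]
        covered_byD[OF AD(4)] covered_byD[OF AD(5)] ne by auto
  qed
  note inj = inj_on_hclass_window[OF D]
  have finG: "finite ?G"
    using finite_subset[OF C'(1) finite_window[OF D]] by simp
  have card_hclass: "card (hclass ` Z) = card Z" if "Z \<subseteq> window D" for Z
    by (rule card_image[OF inj_on_subset[OF inj that]])
  have GD: "?G \<subseteq> window D"
    using C'(1) by blast
  have "L \<in> C"
    using C(2) by blast
  then have "card C = card ?G + 1"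
    using card_Suc_Diff1[of C L] finite_subset[OF C'(1) finite_window[OF D]] by simp
  then have card_C: "card (hclass ` C) = card (hclass ` ?G) + 1"
    by (simp only: card_hclass[OF C'(1)] card_hclass[OF GD])
  have "card ?C' = card ?G + 1"
    using \<open>M \<notin> C\<close> finG by simp
  then have card_C': "card (hclass ` ?C') = card (hclass ` ?G) + 1"
    by (simp only: card_hclass[OF maximal_chainD(1)[OF C'_max]] card_hclass[OF GD])
  have mem: "hclass X \<in> hclass ` Z \<longleftrightarrow> X \<in> Z" if "X \<in> window D" "Z \<subseteq> window D" for X Z
    using inj_on_image_mem_iff[OF inj that] .
  have "adjacent ord \<pi> scale (hclass ` C) (hclass ` ?C')"
    unfolding adjacent_def codim_one_face_def
    using chamber_if_maximal_chain[OF D C(1)] chamber_if_maximal_chain[OF D C'_max]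
      card_C card_C' by (intro conjI exI[of _ "hclass ` ?G"]) auto
  moreover have "hclass L \<in> hclass ` C" "hclass M \<notin> hclass ` C"
    using mem lat C'(1) C(2) \<open>M \<notin> C\<close> by auto
  moreover have "hclass M \<in> hclass ` ?C'" "hclass L \<notin> hclass ` ?C'"
    using mem[of _ ?C'] lat maximal_chainD(1)[OF C'_max] ne by auto
  ultimately show ?thesis
    unfolding close_def by blast
qed

lemma close_eq_image:
  assumes "lattice L"
  shows "{t'. close ord \<pi> scale (hclass L) t'} = hclass ` {M. exchangeable L M}"
  using close_imp_exchangeable[OF assms] exchangeable_imp_close[OF assms] by blast

end

section \<open>Counting exchangeable lattices\<close>

context affine_building
begin

lemma common_lower_cover_unique:
  assumes "A \<lhd> L" "A \<lhd> M" "M \<noteq> L"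
  shows "A = L \<inter> M"
proof (rule ccontr)
  note AL = covered_byD[OF assms(1)] and AM = covered_byD[OF assms(2)]
  assume "A \<noteq> L \<inter> M"
  then have "L \<inter> M = L"
    using AL(5)[OF submod_Int[OF AL(2) AM(2)]] AL(4) AM(4) by auto
  then have "L \<subseteq> M" by blast
  then show False
    using AM(5)[OF AL(2,4)] AL(3) assms(3) by auto
qed

lemma common_upper_cover_unique:
  assumes "L \<lhd> D" "M \<lhd> D" "L \<lhd> D'" "M \<lhd> D'" "M \<noteq> L"
  shows "D = D'"
proof -
  have le: "D \<subseteq> D'" if D: "L \<lhd> D" "M \<lhd> D" and D': "L \<lhd> D'" "M \<lhd> D'" for D D'
  proof (rule ccontr)
    assume "\<not> D \<subseteq> D'"
    note LD = covered_byD[OF D(1)] and MD = covered_byD[OF D(2)]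
      and LD' = covered_byD[OF D'(1)] and MD' = covered_byD[OF D'(2)]
    have "D \<inter> D' = L"
      using LD(5)[OF submod_Int[OF LD(2) LD'(2)]] LD(4) LD'(4) \<open>\<not> D \<subseteq> D'\<close> by auto
    then have "M \<subseteq> L"
      using MD(4) MD'(4) by blast
    then show False
      using MD(5)[OF LD(1) _ LD(4)] LD(3) assms(5) by auto
  qed
  show ?thesis
    using le[OF assms(1-4)] le[OF assms(3,4,1,2)] by (rule subset_antisym)
qed

text \<open>If \<open>M\<close> and \<open>b \<odot> M\<close> are both exchangeable with \<open>L\<close> and \<open>ord b > 0\<close>, then
  \<open>b \<odot> M \<subseteq> \<pi>M \<subseteq> \<pi>D \<subseteq> A \<subseteq> L\<close>, although \<open>b \<odot> M\<close> and \<open>L\<close> are distinct with a common cover.  By symmetry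
  the ratio of two homothetic exchangeable lattices is a unit.\<close>

lemma inj_on_hclass_exchangeable: "inj_on hclass {M. exchangeable L M}"
proof (rule inj_onI)
  have aux: "ord b \<le> 0" if M: "exchangeable L M" and bM: "exchangeable L (b \<odot> M)" and b: "b \<noteq> 0" for M b
  proof (rule ccontr)
    assume ord_b: "\<not> ord b \<le> 0"
    obtain A D where A: "\<pi> \<odot> D \<subseteq> A" "A \<lhd> L" "M \<lhd> D"
      using M unfolding exchangeable_def by (elim exE conjE)
    obtain D' where D': "b \<odot> M \<noteq> L" "L \<lhd> D'" "b \<odot> M \<lhd> D'"
      using bM unfolding exchangeable_def by (elim exE conjE)
    have "b \<odot> M \<subseteq> \<pi> \<odot> M"
      using ord_b by (intro dilate_le_uniformizer covered_byD(1)[OF A(3)] b) simp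
    also have "\<pi> \<odot> M \<subseteq> \<pi> \<odot> D"
      by (rule image_mono[OF covered_byD(4)[OF A(3)]])
    also note A(1)
    also have "A \<subseteq> L"
      by (rule covered_byD(4)[OF A(2)])
    finally have "b \<odot> M \<subseteq> L" .
    then show False
      using covered_byD(5)[OF D'(3) covered_byD(1)[OF D'(2)]] covered_byD(3,4)[OF D'(2)] D'(1) by auto
  qed
  fix M N assume M: "M \<in> {M. exchangeable L M}" and N: "N \<in> {M. exchangeable L M}"
    and eq: "hclass M = hclass N"
  obtain a where a: "a \<noteq> 0" "N = a \<odot> M"
    using hclass_eqD[OF eq] by (elim exE conjE)
  have "ord a \<le> 0"
    using aux[of M a] M N a by (simp only: mem_Collect_eq) simp
  moreover have "inverse a \<odot> N = M"
    unfolding a(2) by (rule dilate_inverse(1)[OF a(1)])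
  then have "ord (inverse a) \<le> 0"
    using aux[of N "inverse a"] M N a(1) by simp
  ultimately have ord_a: "ord a = 0"
    using ord_inverse[OF a(1)] by simp
  have "submod M"
    using M covered_byD(2) unfolding exchangeable_def by blast
  then show "M = N"
    unfolding a(2) by (rule dilate_unit[OF _ a(1) ord_a, symmetric])
qed

text \<open>The quotient \<open>D/A\<close> has \<open>q ^ 2\<close> elements, and every line in it is also a hyperplane; so there are
  \<open>(q ^ 2 - 1)/(q - 1)\<close> choices.\<close>

lemma card_middle_lattices:
  assumes L: "lattice L" and AL: "A \<lhd> L" and LD: "L \<lhd> D" and DA: "\<pi> \<odot> D \<subseteq> A"
  shows "card {M. A \<lhd> M \<and> M \<lhd> D} = q + 1" "finite {M. A \<lhd> M \<and> M \<lhd> D}"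
proof -
  note A = covered_byD[OF AL] and D = covered_byD[OF LD]
  have AD: "A \<subseteq> D"
    using A(4) D(4) by (rule order_trans)
  have latD: "lattice D"
    by (rule exchangeable_lattices(1)[OF L DA AL LD AL LD])
  have fin: "finite (cosets A D)"
    by (rule card_cosets_mult(2)[OF submod_dilate[OF D(2)] A(1) D(2) DA AD
          finite_cosets_dilate_lattice[OF latD]])
  have index: "card (cosets A M) = q" if "A \<lhd> M" "M \<subseteq> D" for M
    using card_cosets_covered_by[OF that(1)] order_trans[OF image_mono[OF that(2)] DA] by blast
  have "card (cosets L D) = q"
    using card_cosets_covered_by[OF LD] order_trans[OF DA A(4)] by blast
  then have card_AD: "card (cosets A D) = q * q"
    using card_cosets_mult(1)[OF A(1,2) D(2) A(4) D(4) fin] index[OF AL D(4)] by simp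
  have "M \<lhd> D" if M: "A \<lhd> M" "M \<subseteq> D" for M
  proof -
    note AM = covered_byD[OF M(1)]
    have "q * card (cosets M D) = q * q"
      using card_cosets_mult(1)[OF AM(1,2) D(2) AM(4) M(2) fin] index[OF M] card_AD by simp
    then have "card (cosets M D) = q"
      using q_ge_2 by simp
    then show ?thesis
      by (rule covered_by_if_card_cosets[OF AM(2) D(2) M(2) order_trans[OF DA AM(4)]])
  qed
  then have eq: "{M. A \<lhd> M \<and> M \<lhd> D} = {M. A \<lhd> M \<and> M \<subseteq> D}"
    using covered_byD(4) by blast
  note lines = card_lines[OF A(1) D(2) AD DA fin]
  show "finite {M. A \<lhd> M \<and> M \<lhd> D}"
    unfolding eq by (rule lines(2))
  obtain r where r: "q = Suc (Suc r)"
    using q_ge_2 by (metis add_2_eq_Suc le_Suc_ex)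
  have "card {M. A \<lhd> M \<and> M \<subseteq> D} * (q - 1) = (q + 1) * (q - 1)"
    using lines(1) card_AD r by simp
  moreover have "q - 1 \<noteq> 0"
    using q_ge_2 by simp
  ultimately show "card {M. A \<lhd> M \<and> M \<lhd> D} = q + 1"
    unfolding eq by (simp only: mult_cancel2) simp
qed

text \<open>Dilating by \<open>\<pi>\<close> turns the covers \<open>D\<close> of \<open>L\<close> into covers of \<open>\<pi>L\<close>, and those contained in \<open>A\<close> are the
  lines of \<open>A/\<pi>L\<close>.\<close>

lemma card_upper_covers:
  assumes L: "lattice L" and A: "\<pi> \<odot> L \<subseteq> A" "A \<lhd> L"
  shows "card {D. L \<lhd> D \<and> \<pi> \<odot> D \<subseteq> A} * (q - 1) + 1 = q ^ (dim UNIV - 1)"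
    and "finite {D. L \<lhd> D \<and> \<pi> \<odot> D \<subseteq> A}"
proof -
  let ?D = "{D. L \<lhd> D \<and> \<pi> \<odot> D \<subseteq> A}" and ?E = "{E. \<pi> \<odot> L \<lhd> E \<and> E \<subseteq> A}"
  note AL = covered_byD[OF A(2)]
  note subL = submod_dilate[OF AL(2), of \<pi>]
  note fin = finite_cosets_dilate_lattice[OF L]
  have inj: "inj_on (\<lambda>D. \<pi> \<odot> D) ?D"
    by (rule inj_onI) (simp only: dilate_eq_iff[OF uniformizer_nonzero])
  have img: "(\<lambda>D. \<pi> \<odot> D) ` ?D = ?E"
  proof (intro set_eqI iffI)
    fix E assume "E \<in> (\<lambda>D. \<pi> \<odot> D) ` ?D"
    then obtain D where D: "L \<lhd> D" "\<pi> \<odot> D \<subseteq> A" "E = \<pi> \<odot> D"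
      by (elim imageE CollectE conjE)
    then show "E \<in> ?E"
      using dilate_covered_by[OF uniformizer_nonzero D(1)] by simp
  next
    fix E assume E: "E \<in> ?E"
    have eq: "\<pi> \<odot> inverse \<pi> \<odot> E = E"
      by (rule dilate_inverse(2)[OF uniformizer_nonzero])
    have "L \<lhd> inverse \<pi> \<odot> E"
      using E dilate_covered_by_iff[OF uniformizer_nonzero, of L "inverse \<pi> \<odot> E"]
      by (simp only: eq mem_Collect_eq)
    then have "inverse \<pi> \<odot> E \<in> ?D"
      using E by (simp only: eq mem_Collect_eq)
    then show "E \<in> (\<lambda>D. \<pi> \<odot> D) ` ?D"
      by (rule image_eqI[rotated]) (rule eq[symmetric])
  qed
  have finA: "finite (cosets (\<pi> \<odot> L) A)"
    by (rule finite_cosets_subset[OF fin AL(4)])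
  have piA: "\<pi> \<odot> A \<subseteq> \<pi> \<odot> L"
    by (rule image_mono[OF AL(4)])
  note lines = card_lines[OF subL AL(1) A(1) piA finA]
  have "card (cosets (\<pi> \<odot> L) A) * q = q ^ dim UNIV"
    using card_cosets_mult(1)[OF subL AL(1,2) A(1) AL(4) fin] card_cosets_covered_by[OF A(2,1)]
      card_cosets_dilate_lattice[OF L] by simp
  moreover have "q ^ dim UNIV = q ^ (dim UNIV - 1) * q"
    using power_minus_mult[of "dim UNIV" q] dim_ge_2 by simp
  ultimately have "card (cosets (\<pi> \<odot> L) A) = q ^ (dim UNIV - 1)"
    using q_ge_2 by simp
  moreover have "card ?D = card ?E"
    using card_image[OF inj] img by simp
  ultimately show "card ?D * (q - 1) + 1 = q ^ (dim UNIV - 1)"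
    using lines(1) by simp
  show "finite ?D"
    using finite_imageD[OF _ inj] img lines(2) by simp
qed

text \<open>Since \<open>A\<close> and \<open>D\<close> are determined by \<open>M\<close>, the count is a disjoint union over the pairs \<open>(A, D)\<close>, each
  contributing \<open>q\<close> lattices: those in the middle other than \<open>L\<close>.\<close>

lemma card_exchangeable:
  assumes L: "lattice L"
  shows "finite {M. exchangeable L M}"
    and "real (card {M. exchangeable L M}) =
      (real q ^ dim UNIV - 1) / (real q - 1) * ((real q ^ (dim UNIV - 1) - 1) / (real q - 1)) * real q"
proof -
  note subL = submod_lattice[OF L]
  define lower where "lower = {A. \<pi> \<odot> L \<subseteq> A \<and> A \<lhd> L}"
  define upper where "upper A = {D. L \<lhd> D \<and> \<pi> \<odot> D \<subseteq> A}" for A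
  define middle where "middle A D = {M. A \<lhd> M \<and> M \<lhd> D} - {L}" for A D
  have lower_lattice: "\<pi> \<odot> L \<subseteq> A" "A \<lhd> L" if "A \<in> lower" for A
    using that by (simp_all add: lower_def)
  have fin_lower: "finite lower"
    unfolding lower_def
    by (rule finite_subset[OF _ finite_intermediate_submods[OF submod_dilate[OF subL]
            finite_cosets_dilate_lattice[OF L]]]) (auto dest: covered_byD)
  have fin_upper: "finite (upper A)" if "A \<in> lower" for A
    unfolding upper_def using card_upper_covers(2)[OF L] lower_lattice[OF that] by blast
  have eq: "{M. exchangeable L M} = (\<Union>(A, D)\<in>Sigma lower upper. middle A D)"
  proof (intro set_eqI iffI)
    fix M assume "M \<in> {M. exchangeable L M}"
    then have "exchangeable L M" by simp
    then obtain A D where AD: "M \<noteq> L" "\<pi> \<odot> D \<subseteq> A" "A \<lhd> L" "L \<lhd> D" "A \<lhd> M" "M \<lhd> D"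
      unfolding exchangeable_def by (elim exE conjE)
    have "\<pi> \<odot> L \<subseteq> A"
      using image_mono[OF covered_byD(4)[OF AD(4)]] AD(2) by (rule order_trans)
    then have "(A, D) \<in> Sigma lower upper" "M \<in> middle A D"
      using AD by (simp_all add: lower_def upper_def middle_def)
    then show "M \<in> (\<Union>(A, D)\<in>Sigma lower upper. middle A D)"
      by blast
  next
    fix M assume "M \<in> (\<Union>(A, D)\<in>Sigma lower upper. middle A D)"
    then obtain A D where "A \<in> lower" "D \<in> upper A" "M \<in> middle A D" by blast
    then show "M \<in> {M. exchangeable L M}"
      unfolding exchangeable_def lower_def upper_def middle_def
      by (intro CollectI conjI exI[of _ A] exI[of _ D]) simp_all
  qed
  have middle: "card (middle A D) = q" "finite (middle A D)" if "A \<in> lower" "D \<in> upper A" for A D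
  proof -
    have "A \<lhd> L" "L \<lhd> D" "\<pi> \<odot> D \<subseteq> A"
      using that by (simp_all add: lower_def upper_def)
    then show "card (middle A D) = q" "finite (middle A D)"
      using card_middle_lattices[OF L, of A D] by (simp_all add: middle_def)
  qed
  have disjoint: "p = p'"
    if "p \<in> Sigma lower upper" "p' \<in> Sigma lower upper"
      "M \<in> middle (fst p) (snd p)" "M \<in> middle (fst p') (snd p')" for p p' M
  proof -
    have 1: "fst p \<lhd> L" "fst p \<lhd> M" "L \<lhd> snd p" "M \<lhd> snd p" "M \<noteq> L"
      and 2: "fst p' \<lhd> L" "fst p' \<lhd> M" "L \<lhd> snd p'" "M \<lhd> snd p'"
      using that by (auto simp: lower_def upper_def middle_def)
    have "fst p = fst p'"
      using common_lower_cover_unique[OF 1(1,2,5)] common_lower_cover_unique[OF 2(1,2) 1(5)] by simp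
    moreover have "snd p = snd p'"
      by (rule common_upper_cover_unique[OF 1(3,4) 2(3,4) 1(5)])
    ultimately show ?thesis
      by (rule prod_eqI)
  qed
  have fin_pairs: "finite (Sigma lower upper)"
    using fin_lower fin_upper by (rule finite_SigmaI)
  show "finite {M. exchangeable L M}"
    unfolding eq using fin_pairs middle(2) by (intro finite_UN_I) auto
  have "card {M. exchangeable L M} = (\<Sum>p\<in>Sigma lower upper. card (middle (fst p) (snd p)))"
    unfolding eq case_prod_beta
  proof (rule card_UN_disjoint[OF fin_pairs])
    show "\<forall>p\<in>Sigma lower upper. finite (middle (fst p) (snd p))"
      using middle(2) by auto
    show "\<forall>p\<in>Sigma lower upper. \<forall>p'\<in>Sigma lower upper. p \<noteq> p' \<longrightarrow>
        middle (fst p) (snd p) \<inter> middle (fst p') (snd p') = {}"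
      using disjoint by blast
  qed
  also have "\<dots> = (\<Sum>p\<in>Sigma lower upper. q)"
    using middle(1) by (intro sum.cong) auto
  also have "\<dots> = (\<Sum>A\<in>lower. card (upper A)) * q"
    using fin_lower fin_upper by simp
  finally have card_eq: "real (card {M. exchangeable L M}) = (\<Sum>A\<in>lower. real (card (upper A))) * real q"
    by simp
  have solve: "real k = (real q ^ m - 1) / (real q - 1)" if "k * (q - 1) + 1 = q ^ m" for k m
  proof -
    have "real (k * (q - 1) + 1) = real (q ^ m)"
      using that by (simp only:)
    then have "real k * (real q - 1) + 1 = real q ^ m"
      using q_ge_2 by (simp add: of_nat_diff)
    then show ?thesis
      using q_ge_2 by (simp add: field_simps)
  qed
  have "real (card (upper A)) = (real q ^ (dim UNIV - 1) - 1) / (real q - 1)" if "A \<in> lower" for A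
    using card_upper_covers(1)[OF L] lower_lattice[OF that] unfolding upper_def by (intro solve) blast
  then have "(\<Sum>A\<in>lower. real (card (upper A))) =
      real (card lower) * ((real q ^ (dim UNIV - 1) - 1) / (real q - 1))"
    by simp
  moreover have "real (card lower) = (real q ^ dim UNIV - 1) / (real q - 1)"
    unfolding lower_def
    by (intro solve card_hyperplanes submod_dilate subL card_cosets_dilate_lattice L order_refl)
      (use dilate_psubset_lattice[OF L] in blast)
  ultimately show "real (card {M. exchangeable L M}) =
      (real q ^ dim UNIV - 1) / (real q - 1) * ((real q ^ (dim UNIV - 1) - 1) / (real q - 1)) * real q"
    using card_eq by simp
qed

end

theorem proposition1p1:
  fixes ord :: "'a::field \<Rightarrow> int"
    and \<pi> :: 'a
    and q n :: nat
    and scale :: "'a \<Rightarrow> 'b::ab_group_add \<Rightarrow> 'b"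
    and t :: "'b set set"
  assumes "local_field ord \<pi> q"
    and "vector_space scale"
    and "vector_space.dim scale (UNIV :: 'b set) = n"
    and "n \<ge> 3"
    and "t \<in> vertices ord scale"
  shows "finite {t'. close ord \<pi> scale t t'} \<and>
           real (card {t'. close ord \<pi> scale t t'}) =
           (real q ^ n - 1) / (real q - 1) * ((real q ^ (n - 1) - 1) / (real q - 1)) * real q"
proof -
  interpret K: local_field ord \<pi> q by fact
  interpret V: vector_space scale by fact
  obtain B where B: "V.independent B" "V.span B = UNIV" "card B = n"
    using V.basis_exists[of UNIV] assms(3) by (metis top.extremum_uniqueI)
  have "finite B"
    using B(3) assms(4) by (intro card_ge_0_finite) simp
  then interpret affine_building ord \<pi> q scale B
    using B assms(3,4) by unfold_locales auto
  obtain L where L: "lattice L" "t = hclass L"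
    using assms(5) by (auto simp: vertices_def)
  have "card {t'. close ord \<pi> scale t t'} = card {M. exchangeable L M}"
    unfolding L(2) close_eq_image[OF L(1)] by (rule card_image[OF inj_on_hclass_exchangeable])
  moreover have "finite {t'. close ord \<pi> scale t t'}"
    unfolding L(2) close_eq_image[OF L(1)] using card_exchangeable(1)[OF L(1)] by (rule finite_imageI)
  ultimately show ?thesis
    using card_exchangeable(2)[OF L(1)] assms(3) by simp
qed

end
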